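(* Assume that the set $\mathcal{U}$ of admissible controls is nonempty, and that every optimal process of the $L^1$ robust problem $\inf_{u\in\mathcal{U}}J_1(u)$ is normal and satisfies the average controllability-like condition, i.e., for every optimal process $\bigl(u^*,\{x^*(\cdot;\alpha):\alpha\in\mathcal{A}\}\bigr)$ of that problem there are multipliers $(\eta,\Lambda,\{p(\cdot;\alpha)\})$ satisfying the robust maximum principle conditions (a)--(e) listed in the context such that: (i) $\eta>0$; (ii) with $\mathcal{A}^{\rm act}=\{\alpha\in\mathcal{A}:\psi(x^*(T;\alpha))=0\}$ and $\Lambda^{\rm act}=\Lambda|_{\mathcal{A}^{\rm act}}$, for every measurable map $\alpha\mapsto v(\alpha)\in\mathbb{R}^d$ with $v(\alpha)\in N_C(x^*(T;\alpha))$ that is not $\Lambda^{\rm act}$-a.e. zero there exists $m\in\{1,\ldots,d-1\}$ with $$\int_{\mathcal{A}^{\rm act}}\langle A(\alpha)^m b(\alpha),v(\alpha)\rangle\,\Lambda^{\rm act}(d\alpha)\neq 0.$$ Define the sets of optimal controls $$\mathcal{U}_0^*=\{u_0^*\in\mathcal{U}: J_0(u_0^* )\le J_0(u)\ \text{for all }u\in\mathcal{U}\},\qquad \mathcal{U}_1^*=\{u_1^*\in\mathcal{U}: J_1(u_1^* )\le J_1(u)\ \text{for all }u\in\mathcal{U}\}.$$ Then $\mathcal{U}_0^*=\mathcal{U}_1^*$.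
   Context: Setting. Let $d,\nu\in\mathbb{N}$ and $T>0$ be fixed. $\mathcal{A}\subset\mathbb{R}^\nu$ is a nonempty, compact, convex set of uncertain parameters. The maps $\alpha\mapsto A(\alpha)\in\mathbb{R}^{d\times d}$ and $\alpha\mapsto b(\alpha)\in\mathbb{R}^d$ are continuously differentiable on an open neighbourhood of $\mathcal{A}$. The initial state $\bar x\in\mathbb{R}^d$ is given (the same for all $\alpha$). For $u\in L^\infty([0,T];\mathbb{R})$ and $\alpha\in\mathcal{A}$, $x_u(\cdot;\alpha)\in W^{1,1}([0,T];\mathbb{R}^d)$ is the solution of $$\dot x(t;\alpha)=A(\alpha)x(t;\alpha)+b(\alpha)u(t)\ \text{ for a.e. } t\in[0,T],\qquad x(0;\alpha)=\bar x.$$ The function $\psi:\mathbb{R}^d\to\mathbb{R}$ is continuously differentiable and convex, and the terminal set $C=\{\xi\in\mathbb{R}^d:\psi(\xi)\le 0\}$ is compact and convex. The normal cone to $C$ at $x\in C$ is $N_C(x)=\{v\in\mathbb{R}^d:\langle v,y-x\rangle\le 0\text{ for all }y\in C\}$. Admissible controls: $\mathcal{U}$ is the set of $u\in L^\infty([0,T];\mathbb{R})$ with $u(t)\in[-1,1]$ for a.e. $t\in[0,T]$ and $\psi(x_u(T;\alpha))\le 0$ for all $\alpha\in\mathcal{A}$. Objectives: $J_0(u)$ is the Lebesgue measure of $\{t\in[0,T]:u(t)\ne0\}$, and $J_1(u)=\int_0^T|u(t)|\,dt$. An optimal process of the $L^1$ problem is $(u^*,\{x^*(\cdot;\alpha)=x_{u^*}(\cdot;\alpha)\})$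 with $u^*\in\mathcal{U}$ minimizing $J_1$ over $\mathcal{U}$. Robust maximum principle conditions for $(u^*,\{x^*(\cdot;\alpha)\})$: $\eta\in[0,1]$ is a scalar, $\Lambda$ is a non-negative Radon measure on $\mathcal{A}$, and $p(\cdot;\alpha)\in W^{1,1}([0,T];\mathbb{R}^d)$ is defined for $\Lambda$-a.e. $\alpha\in\operatorname{supp}(\Lambda)$, with: (a) $\eta+\Lambda(\mathcal{A})=1$; (b) for $\Lambda$-a.e. $\alpha$, $-\dot p(t;\alpha)=A(\alpha)^\top p(t;\alpha)$ for a.e. $t\in[0,T]$; (c) for $\Lambda$-a.e. $\alpha$ there is $\mu(\alpha)\ge0$ with $-p(T;\alpha)=\mu(\alpha)\nabla\psi(x^*(T;\alpha))$; (d) $\operatorname{supp}(\Lambda)\subset\{\alpha\in\mathcal{A}:\psi(x^*(T;\alpha))=0\}$, and for every $\alpha\in\operatorname{supp}(\Lambda)$, $\mu(\alpha)>0$ only if $\psi(x^*(T;\alpha))=0$; (e) for a.e. $t\in[0,T]$, $u^*(t)\in\operatorname{argmax}_{v\in[-1,1]}\{\varphi(t)v-\eta|v|\}$, where $\varphi(t)=\int_{\mathcal{A}}p(t;\alpha)^\top b(\alpha)\Lambda(d\alpha)$. *)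

theory Defs
  imports "HOL-Analysis.Analysis"
begin

definition C1_on :: "('a::real_normed_vector \<Rightarrow> 'b::real_normed_vector) \<Rightarrow> 'a set \<Rightarrow> bool" where
  "C1_on f V \<longleftrightarrow> (\<exists>f' :: 'a \<Rightarrow> 'a \<Rightarrow>\<^sub>L 'b.
     (\<forall>x\<in>V. (f has_derivative blinfun_apply (f' x)) (at x)) \<and> continuous_on V f')"

definition gradient :: "('a::real_inner \<Rightarrow> real) \<Rightarrow> 'a \<Rightarrow> 'a" where
  "gradient f x = (THE g. GDERIV f x :> g)"

(* W^{1,1}([0,T]) is taken in the usual sense of absolutely continuous functions:
   x is the primitive of an L^1 function y, and y is the (a.e. unique) derivative of x.
   Values outside [0,T] are irrelevant. *)
definition has_W11_deriv :: "real \<Rightarrow> (real \<Rightarrow> 'a::euclidean_space) \<Rightarrow> (real \<Rightarrow> 'a) \<Rightarrow> bool" where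
  "has_W11_deriv T x y \<longleftrightarrow>
     y absolutely_integrable_on {0..T} \<and> (\<forall>t\<in>{0..T}. x t = x 0 + integral {0..t} y)"

(* L^infinity([0,T]) at the level of representatives; all notions below depend only on
   the a.e.-class of a control on [0,T]. *)
definition Linf :: "real \<Rightarrow> (real \<Rightarrow> real) set" where
  "Linf T = {u. u \<in> borel_measurable (lebesgue_on {0..T}) \<and>
                (\<exists>K. AE t in lebesgue_on {0..T}. \<bar>u t\<bar> \<le> K)}"

definition is_solution ::
  "('p \<Rightarrow> real^'d^'d) \<Rightarrow> ('p \<Rightarrow> real^'d) \<Rightarrow> real^'d \<Rightarrow> real \<Rightarrow> (real \<Rightarrow> real) \<Rightarrow> 'p \<Rightarrow>
   (real \<Rightarrow> real^'d) \<Rightarrow> bool" where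
  "is_solution A b xbar T u \<alpha> x \<longleftrightarrow>
     (\<exists>y. has_W11_deriv T x y \<and>
          (AE t in lebesgue_on {0..T}. y t = A \<alpha> *v x t + u t *\<^sub>R b \<alpha>)) \<and>
     x 0 = xbar"

(* For u in L^infinity a solution exists and is unique on [0,T], so the choice only affects
   values outside [0,T]. *)
definition trajectory ::
  "('p \<Rightarrow> real^'d^'d) \<Rightarrow> ('p \<Rightarrow> real^'d) \<Rightarrow> real^'d \<Rightarrow> real \<Rightarrow> (real \<Rightarrow> real) \<Rightarrow> 'p \<Rightarrow>
   (real \<Rightarrow> real^'d)" where
  "trajectory A b xbar T u \<alpha> = (SOME x. is_solution A b xbar T u \<alpha> x)"

definition terminal_set :: "(real^'d \<Rightarrow> real) \<Rightarrow> (real^'d) set" where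
  "terminal_set \<psi> = {\<xi>. \<psi> \<xi> \<le> 0}"

definition normal_cone :: "'a::real_inner set \<Rightarrow> 'a \<Rightarrow> 'a set" where
  "normal_cone C x = {v. \<forall>y\<in>C. v \<bullet> (y - x) \<le> 0}"

definition admissible ::
  "('p \<Rightarrow> real^'d^'d) \<Rightarrow> ('p \<Rightarrow> real^'d) \<Rightarrow> real^'d \<Rightarrow> real \<Rightarrow> (real^'d \<Rightarrow> real) \<Rightarrow> 'p set \<Rightarrow>
   (real \<Rightarrow> real) set" where
  "admissible A b xbar T \<psi> P =
     {u \<in> Linf T. (AE t in lebesgue_on {0..T}. u t \<in> {-1..1}) \<and>
                  (\<forall>\<alpha>\<in>P. \<psi> (trajectory A b xbar T u \<alpha> T) \<le> 0)}"

definition J0 :: "real \<Rightarrow> (real \<Rightarrow> real) \<Rightarrow> real" where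
  "J0 T u = measure lebesgue {t \<in> {0..T}. u t \<noteq> 0}"

definition J1 :: "real \<Rightarrow> (real \<Rightarrow> real) \<Rightarrow> real" where
  "J1 T u = (LINT t|lebesgue_on {0..T}. \<bar>u t\<bar>)"

definition minimizers :: "('u \<Rightarrow> real) \<Rightarrow> 'u set \<Rightarrow> 'u set" where
  "minimizers J U = {u \<in> U. \<forall>w\<in>U. J u \<le> J w}"

(* On a compact subset P of R^n the non-negative Radon measures are exactly the finite Borel
   measures. *)
definition radon_measure_on :: "'p::euclidean_space set \<Rightarrow> 'p measure \<Rightarrow> bool" where
  "radon_measure_on P \<Lambda> \<longleftrightarrow> sets \<Lambda> = sets (restrict_space borel P) \<and> finite_measure \<Lambda>"

definition measure_supp :: "'p::topological_space measure \<Rightarrow> 'p set" where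
  "measure_supp \<Lambda> =
     {\<alpha> \<in> space \<Lambda>. \<forall>W. open W \<longrightarrow> \<alpha> \<in> W \<longrightarrow> emeasure \<Lambda> (W \<inter> space \<Lambda>) > 0}"

definition active_set :: "(real^'d \<Rightarrow> real) \<Rightarrow> 'p set \<Rightarrow> ('p \<Rightarrow> real^'d) \<Rightarrow> 'p set" where
  "active_set \<psi> P xT = {\<alpha> \<in> P. \<psi> (xT \<alpha>) = 0}"

definition phi ::
  "('p \<Rightarrow> real^'d) \<Rightarrow> 'p measure \<Rightarrow> (real \<Rightarrow> 'p \<Rightarrow> real^'d) \<Rightarrow> real \<Rightarrow> real" where
  "phi b \<Lambda> p t = (LINT \<alpha>|\<Lambda>. p t \<alpha> \<bullet> b \<alpha>)"

(* p t alpha and mu alpha are total functions, constrained only for almost every alpha.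
   The integrability clause says that the integral defining phi exists on [0,T]; without it
   the Bochner integral would silently be 0. *)
definition robust_pmp ::
  "('p::euclidean_space \<Rightarrow> real^'d^'d) \<Rightarrow> ('p \<Rightarrow> real^'d) \<Rightarrow> real \<Rightarrow> (real^'d \<Rightarrow> real) \<Rightarrow> 'p set \<Rightarrow>
   (real \<Rightarrow> real) \<Rightarrow> ('p \<Rightarrow> real \<Rightarrow> real^'d) \<Rightarrow>
   real \<Rightarrow> 'p measure \<Rightarrow> (real \<Rightarrow> 'p \<Rightarrow> real^'d) \<Rightarrow> ('p \<Rightarrow> real) \<Rightarrow> bool" where
  "robust_pmp A b T \<psi> P u x \<eta> \<Lambda> p \<mu> \<longleftrightarrow>
     \<eta> \<in> {0..1} \<and> radon_measure_on P \<Lambda> \<and>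
     \<eta> + measure \<Lambda> P = 1 \<and>
     (AE \<alpha> in \<Lambda>. \<exists>q. has_W11_deriv T (\<lambda>t. p t \<alpha>) q \<and>
        (AE t in lebesgue_on {0..T}. - q t = transpose (A \<alpha>) *v p t \<alpha>)) \<and>
     (AE \<alpha> in \<Lambda>. \<mu> \<alpha> \<ge> 0 \<and> - p T \<alpha> = \<mu> \<alpha> *\<^sub>R gradient \<psi> (x \<alpha> T)) \<and>
     measure_supp \<Lambda> \<subseteq> {\<alpha> \<in> P. \<psi> (x \<alpha> T) = 0} \<and>
     (\<forall>\<alpha>\<in>measure_supp \<Lambda>. \<mu> \<alpha> > 0 \<longrightarrow> \<psi> (x \<alpha> T) = 0) \<and>
     (\<forall>t\<in>{0..T}. integrable \<Lambda> (\<lambda>\<alpha>. p t \<alpha> \<bullet> b \<alpha>)) \<and>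
     (AE t in lebesgue_on {0..T}.
        is_arg_max (\<lambda>v. phi b \<Lambda> p t * v - \<eta> * \<bar>v\<bar>) (\<lambda>v. v \<in> {-1..1}) (u t))"

(* The matrix power A^m is iterated application of *v, since ^ on real^'d^'d would be
   componentwise.  The test maps v are those for which the integrals are defined; as the normal
   cone is a cone, a nonzero v can in general be rescaled to a non-integrable one. *)
definition avg_controllability ::
  "('p::euclidean_space \<Rightarrow> real^'d^'d) \<Rightarrow> ('p \<Rightarrow> real^'d) \<Rightarrow> (real^'d \<Rightarrow> real) \<Rightarrow> 'p set \<Rightarrow>
   ('p \<Rightarrow> real^'d) \<Rightarrow> 'p measure \<Rightarrow> bool" where
  "avg_controllability A b \<psi> P xT \<Lambda> \<longleftrightarrow>
     (let \<Lambda>act = restrict_space \<Lambda> (active_set \<psi> P xT) in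
      \<forall>v. v \<in> borel_measurable \<Lambda>act \<longrightarrow>
          (\<forall>\<alpha>\<in>active_set \<psi> P xT. v \<alpha> \<in> normal_cone (terminal_set \<psi>) (xT \<alpha>)) \<longrightarrow>
          (\<forall>m\<in>{1..CARD('d) - 1}. integrable \<Lambda>act (\<lambda>\<alpha>. (((*v) (A \<alpha>)) ^^ m) (b \<alpha>) \<bullet> v \<alpha>)) \<longrightarrow>
          \<not> (AE \<alpha> in \<Lambda>act. v \<alpha> = 0) \<longrightarrow>
          (\<exists>m\<in>{1..CARD('d) - 1}. (LINT \<alpha>|\<Lambda>act. (((*v) (A \<alpha>)) ^^ m) (b \<alpha>) \<bullet> v \<alpha>) \<noteq> 0))"

end

theory Submission
  imports Defs "HOL-Complex_Analysis.Conformal_Mappings"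
begin

text \<open>
Admissible controls satisfy \<open>\<bar>u\<bar> \<le> 1\<close>, so \<open>\<bar>u\<bar>\<close> is at most the indicator function of \<open>{u \<noteq> 0}\<close> and
\<open>J\<^sub>1 \<le> J\<^sub>0\<close>, with equality for controls with values in \<open>{-1, 0, 1}\<close>. If \<open>J\<^sub>1\<close> has minimisers and all of them
take only these values, then \<open>J\<^sub>1\<close> is a lower bound of \<open>J\<^sub>0\<close> that is sharp at each minimiser of \<open>J\<^sub>1\<close>, and the two
sets of minimisers coincide (\<open>minimizers_eq_of_tight_lower_bound\<close>). Two facts remain.

Existence (\<open>minimizers_J1_nonempty\<close>). The end point of a trajectory is affine and \<open>L\<^sup>1\<close>-Lipschitz in the
control, so the admissible set is convex and closed under bounded almost everywhere convergence.
Choosing elements of nearly least \<open>L\<^sup>2\<close> norm in the sublevel sets of \<open>J\<^sub>1\<close> gives, by the parallelogram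
law, a strongly convergent minimising sequence (\<open>L1_minimizer_exists\<close>).

Values (\<open>bang_off_bang\<close>). The maximum condition forces \<open>u(t) \<in> {-1, 0, 1}\<close> unless \<open>\<bar>\<phi>(t)\<bar> = \<eta>\<close>. The switching
function \<open>\<phi>\<close> is an entire function of \<open>T - t\<close> whose \<open>m\<close>-th derivative at \<open>0\<close> is, up to sign, the integral of
\<open>\<langle>A\<^sup>m b, v\<rangle>\<close> in the controllability condition, for a selection \<open>v\<close> of the normal cones built from the terminal
costates. If \<open>\<bar>\<phi>\<bar> = \<eta>\<close> at infinitely many times, then \<open>\<phi>\<close> is constant, the derivatives with \<open>m \<ge> 1\<close> vanish,
controllability gives \<open>v = 0\<close> almost everywhere, and therefore \<open>\<phi> = 0\<close>, contradicting \<open>\<eta> > 0\<close>.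

The controllability condition can only be applied to a measurable \<open>v\<close> with integrable \<open>\<langle>A\<^sup>m b, v\<rangle>\<close>, while the
maximum principle provides integrability of \<open>\<langle>p(t), b\<rangle>\<close> for each \<open>t\<close> and a multiplier
\<open>\<mu>\<close> that may fail to be measurable. The passage from the values of \<open>\<langle>p(t), b\<rangle>\<close> to its Taylor
coefficients has to be uniform in the parameter.
By Cayley--Hamilton, \<open>t \<mapsto> \<langle>p(t), b\<rangle>\<close> solves a monic linear equation of order \<open>d\<close> with coefficients bounded on
the compact parameter set, and for such functions \<open>d\<close> sufficiently close samples dominate all
Taylor coefficients (\<open>coefficients_bounded_by_samples\<close>).
\<close>

section \<open>Powers of a matrix satisfy a uniformly bounded recurrence\<close>

text \<open>
Polynomials act on a vector through an endomorphism \<open>L\<close>, the variable acting as \<open>L\<close>; this is the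
module structure in which the Cayley--Hamilton theorem is a statement about the determinant of
a matrix with polynomial entries. The map \<open>L\<close> is a plain function so that its iterates are the
powers in the controllability condition.
\<close>

definition poly_act :: "('v \<Rightarrow> 'v) \<Rightarrow> real poly \<Rightarrow> 'v \<Rightarrow> 'v::real_vector" where
  "poly_act L p v = (\<Sum>k\<le>degree p. coeff p k *\<^sub>R (L ^^ k) v)"

lemma poly_act_bound:
  assumes "degree p \<le> n"
  shows "poly_act L p v = (\<Sum>k\<le>n. coeff p k *\<^sub>R (L ^^ k) v)"
  unfolding poly_act_def using assms
  by (intro sum.mono_neutral_left) (auto simp: coeff_eq_0)

lemma linear_funpow: "linear L \<Longrightarrow> linear (L ^^ k)" for L :: "'v::real_vector \<Rightarrow> 'v"
proof (induction k)
  case 0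
  then show ?case using linear_id by (simp add: id_def)
next
  case (Suc k)
  then show ?case unfolding funpow.simps by (intro linear_compose) auto
qed

lemma poly_act_0 [simp]: "poly_act L 0 v = 0"
  by (simp add: poly_act_def)

lemma poly_act_add: "poly_act L (p + q) v = poly_act L p v + poly_act L q v"
proof -
  define n where "n = max (degree p) (degree q)"
  have "degree (p + q) \<le> n" "degree p \<le> n" "degree q \<le> n"
    by (auto simp: n_def degree_add_le_max)
  then show ?thesis
    by (simp add: poly_act_bound scaleR_add_left sum.distrib)
qed

lemma poly_act_smult: "poly_act L (smult c p) v = c *\<^sub>R poly_act L p v"
proof -
  have "degree (smult c p) \<le> degree p" by (rule degree_smult_le)
  then show ?thesis
    by (simp add: poly_act_bound[of "smult c p" "degree p"] poly_act_bound[of p "degree p"] scaleR_sum_right)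
qed

lemma linear_poly_act:
  assumes "linear L"
  shows "linear (poly_act L p)"
  unfolding poly_act_def
  by (intro linear_compose_sum ballI linear_compose_scale_right linear_funpow assms)

lemma poly_act_pCons:
  assumes "linear L"
  shows "poly_act L (pCons a p) v = a *\<^sub>R v + L (poly_act L p v)"
proof -
  have "degree (pCons a p) \<le> Suc (degree p)" by (rule degree_pCons_le)
  then have "poly_act L (pCons a p) v = (\<Sum>k\<le>Suc (degree p). coeff (pCons a p) k *\<^sub>R (L ^^ k) v)"
    by (rule poly_act_bound)
  also have "\<dots> = a *\<^sub>R v + (\<Sum>k\<le>degree p. coeff p k *\<^sub>R L ((L ^^ k) v))"
    by (subst sum.atMost_Suc_shift) simp
  also have "(\<Sum>k\<le>degree p. coeff p k *\<^sub>R L ((L ^^ k) v)) = L (poly_act L p v)"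
    unfolding poly_act_def using assms by (simp add: linear_sum linear_scale)
  finally show ?thesis .
qed

lemma poly_act_mult:
  assumes "linear L"
  shows "poly_act L (p * q) v = poly_act L p (poly_act L q v)"
proof (induction p)
  case 0
  then show ?case by simp
next
  case (pCons a p)
  then show ?case
    by (simp add: poly_act_add poly_act_smult poly_act_pCons[OF assms])
qed

lemma poly_act_sum: "poly_act L (\<Sum>i\<in>S. p i) v = (\<Sum>i\<in>S. poly_act L (p i) v)"
  by (induction S rule: infinite_finite_induct) (auto simp: poly_act_add)

text \<open>
The identity \<open>M adj(M) = det(M) I\<close> over a commutative ring: replacing row \<open>j\<close> by row \<open>i\<close> leaves
the determinant unchanged for \<open>i = j\<close> and produces two equal rows otherwise, and the determinant
is linear in the replaced row.
\<close>

lemma row_times_cofactors: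
  fixes M :: "'a::comm_ring_1^'n^'n"
  shows "(\<Sum>k\<in>UNIV. M $ i $ k * det (\<chi> r. if r = j then axis k 1 else M $ r)) =
         (if i = j then det M else 0)"
proof -
  have "(\<Sum>k\<in>UNIV. M $ i $ k * det (\<chi> r. if r = j then axis k 1 else M $ r)) =
        (\<Sum>k\<in>UNIV. det (\<chi> r. if r = j then M $ i $ k *s axis k 1 else M $ r))"
    by (simp add: det_row_mul)
  also have "\<dots> = det (\<chi> r. if r = j then (\<Sum>k\<in>UNIV. M $ i $ k *s axis k 1) else M $ r)"
    by (rule det_linear_row_sum[symmetric]) simp
  also have "\<dots> = det (\<chi> r. if r = j then M $ i else M $ r)"
    by (subst basis_expansion) (rule refl)
  also have "\<dots> = (if i = j then det M else 0)"
  proof (cases "i = j")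
    case True
    then have "(\<chi> r. if r = j then M $ i else M $ r) = M"
      by (simp add: vec_eq_iff)
    with True show ?thesis by simp
  next
    case False
    then show ?thesis
      using det_identical_rows[of i j "\<chi> r. if r = j then M $ i else M $ r"]
      by (simp add: row_def)
  qed
  finally show ?thesis .
qed

definition char_mat :: "real^'d^'d \<Rightarrow> real poly^'d^'d" where
  "char_mat A = (\<chi> i j. (if i = j then [:0, 1:] else 0) - [:A $ i $ j:])"

text \<open>
With the variable acting as \<open>A\<close>, column \<open>i\<close> of \<open>x I - A\<close> sends the standard basis to
\<open>A e\<^sub>i - (\<Sum>k. A\<^sub>k\<^sub>i e\<^sub>k) = 0\<close>. Multiplying these relations by the cofactors leaves the
characteristic polynomial acting on each \<open>e\<^sub>j\<close>.
\<close>

lemma cayley_hamilton: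
  fixes A :: "real^'d^'d"
  shows "poly_act ((*v) A) (det (char_mat A)) v = 0"
proof -
  let ?L = "(*v) A"
  have L: "linear ?L" by simp
  let ?M = "char_mat A"
  define N where "N j k = det (\<chi> r. if r = j then axis k 1 else ?M $ r)" for j k
  have act_diff: "poly_act ?L (p - q) v = poly_act ?L p v - poly_act ?L q v" for p q v
    using poly_act_add[of ?L "p - q" q v] by simp
  have entry: "poly_act ?L (?M $ k $ i) v = (if k = i then A *v v else 0) - (A $ k $ i) *\<^sub>R v" for k i v
    by (simp add: char_mat_def act_diff poly_act_pCons[OF L] linear_0[OF L])
  have rel: "(\<Sum>k\<in>UNIV. poly_act ?L (?M $ k $ i) (axis k 1)) = 0" for i
  proof -
    have "A *v axis i 1 = (\<Sum>k\<in>UNIV. (A $ k $ i) *\<^sub>R axis k 1)"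
      unfolding matrix_vector_mult_basis
      by (simp add: vec_eq_iff column_def axis_def if_distrib cong: if_cong)
    then show ?thesis
      unfolding entry by (simp add: sum_subtractf)
  qed
  have ax: "poly_act ?L (det ?M) (axis j 1) = 0" for j
  proof -
    have "0 = (\<Sum>i\<in>UNIV. poly_act ?L (N j i) (\<Sum>k\<in>UNIV. poly_act ?L (?M $ k $ i) (axis k 1)))"
      unfolding rel using linear_0[OF linear_poly_act[OF L]] by simp
    also have "\<dots> = (\<Sum>i\<in>UNIV. \<Sum>k\<in>UNIV. poly_act ?L (?M $ k $ i * N j i) (axis k 1))"
      by (simp add: linear_sum[OF linear_poly_act[OF L]] mult.commute[of _ "N j _"] poly_act_mult[OF L])
    also have "\<dots> = (\<Sum>k\<in>UNIV. poly_act ?L (\<Sum>i\<in>UNIV. ?M $ k $ i * N j i) (axis k 1))"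
      by (subst sum.swap) (simp add: poly_act_sum)
    also have "\<dots> = (\<Sum>k\<in>UNIV. if k = j then poly_act ?L (det ?M) (axis k 1) else 0)"
      unfolding N_def row_times_cofactors by (intro sum.cong) auto
    finally show ?thesis by simp
  qed
  have "v = (\<Sum>i\<in>UNIV. v $ i *\<^sub>R axis i 1)"
    using basis_expansion[of v] by (simp add: scalar_mult_eq_scaleR)
  then have "poly_act ?L (det ?M) v = (\<Sum>i\<in>UNIV. v $ i *\<^sub>R poly_act ?L (det ?M) (axis i 1))"
    using linear_sum[OF linear_poly_act[OF L]] linear_scale[OF linear_poly_act[OF L]]
    by (metis (no_types, lifting) sum.cong)
  then show ?thesis by (simp add: ax)
qed

text \<open>
In the Leibniz expansion only the identity permutation uses all diagonal entries of \<open>x I - A\<close>;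
every other permutation meets an off-diagonal constant and contributes a lower degree.
\<close>

lemma char_poly_monic:
  fixes A :: "real^'d^'d"
  shows "degree (det (char_mat A)) \<le> CARD('d)" and "coeff (det (char_mat A)) (CARD('d)) = 1"
proof -
  let ?M = "char_mat A"
  have deg_entry: "degree (?M $ i $ j) \<le> (if i = j then 1 else 0)" for i j
    by (auto simp: char_mat_def)
  have deg: "degree (\<Prod>i\<in>UNIV. ?M $ i $ p i) \<le> (\<Sum>i\<in>UNIV. if i = p i then 1 else 0)" for p
    by (rule order_trans[OF degree_prod_sum_le]) (auto intro!: sum_mono deg_entry simp del: sum.delta' simp: o_def)
  have deg': "degree (of_int z * q) \<le> degree q" for z :: int and q :: "real poly"
    using degree_mult_le[of "of_int z" q] by simp
  have term_deg: "degree (of_int (sign p) * (\<Prod>i\<in>UNIV. ?M $ i $ p i)) \<le> CARD('d)" for p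
  proof -
    have "(\<Sum>i\<in>(UNIV::'d set). if i = p i then 1 else 0) \<le> (\<Sum>i\<in>(UNIV::'d set). 1::nat)"
      by (rule sum_mono) auto
    then show ?thesis using deg[of p] deg'[of "sign p" "\<Prod>i\<in>UNIV. ?M $ i $ p i"] by simp
  qed
  show "degree (det ?M) \<le> CARD('d)"
    unfolding det_def by (intro degree_sum_le term_deg) (simp add: finite_permutations)
  have id: "coeff (\<Prod>i\<in>UNIV. ?M $ i $ i) (CARD('d)) = 1"
  proof -
    have e: "?M $ i $ i = [:- A $ i $ i, 1:]" for i by (simp add: char_mat_def)
    have d: "degree (\<Prod>i\<in>UNIV. [:- A $ i $ i, 1:]) = CARD('d)"
      by (subst degree_prod_sum_eq) auto
    have "lead_coeff (\<Prod>i\<in>UNIV. [:- A $ i $ i, 1:]) = 1"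
      by (subst lead_coeff_prod) simp
    then show ?thesis unfolding e d .
  qed
  have other: "coeff (of_int (sign p) * (\<Prod>i\<in>UNIV. ?M $ i $ p i)) (CARD('d)) = 0" if "p \<noteq> id" for p
  proof -
    from that obtain i where i: "p i \<noteq> i" by (metis eq_id_iff)
    have "(\<Sum>i\<in>(UNIV::'d set). if i = p i then 1 else 0) < (\<Sum>i\<in>(UNIV::'d set). 1::nat)"
      by (rule sum_strict_mono_ex1) (use i in \<open>auto intro!: exI[of _ i]\<close>)
    then have "degree (of_int (sign p) * (\<Prod>i\<in>UNIV. ?M $ i $ p i)) < CARD('d)"
      using deg[of p] deg'[of "sign p" "\<Prod>i\<in>UNIV. ?M $ i $ p i"] by simp
    then show ?thesis by (rule coeff_eq_0)
  qed
  have "coeff (det ?M) (CARD('d)) =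
      (\<Sum>p | p permutes (UNIV :: 'd set). if p = id then 1 else 0)"
    unfolding det_def coeff_sum
    by (intro sum.cong refl) (use other id in auto)
  also have "\<dots> = 1"
    by (simp add: finite_permutations permutes_id)
  finally show "coeff (det ?M) (CARD('d)) = 1" .
qed

lemma continuous_coeff_prod:
  fixes f :: "'i \<Rightarrow> 'a::topological_space \<Rightarrow> real poly"
  assumes "\<And>i k. i \<in> I \<Longrightarrow> continuous_on S (\<lambda>x. coeff (f i x) k)"
  shows "continuous_on S (\<lambda>x. coeff (\<Prod>i\<in>I. f i x) k)"
  using assms
proof (induction I arbitrary: k rule: infinite_finite_induct)
  case (insert i I)
  then show ?case
    by (auto simp: coeff_mult intro!: continuous_intros)
qed auto

lemma continuous_char_poly_coeff:
  fixes A :: "'p::topological_space \<Rightarrow> real^'d^'d"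
  assumes "continuous_on S A"
  shows "continuous_on S (\<lambda>\<alpha>. coeff (det (char_mat (A \<alpha>))) k)"
proof -
  have c: "continuous_on S (\<lambda>\<alpha>. coeff (char_mat (A \<alpha>) $ i $ j) k)" for i j k
    by (simp add: char_mat_def coeff_pCons split: nat.split)
      (auto intro!: continuous_intros assms)
  have of_int: "coeff (of_int z * q) k = of_int z * coeff q k" for z :: int and q :: "real poly"
    by (simp add: of_int_poly)
  show ?thesis
    unfolding det_def coeff_sum of_int
    by (intro continuous_intros continuous_coeff_prod c)
qed

text \<open>
The coefficients of the characteristic polynomial are continuous in the matrix, hence bounded on
compact parameter sets. The point is that the recurrence is monic with a bound independent of the
parameter, whatever the rank of the family \<open>v, A v, A\<^sup>2 v, \<dots>\<close>.
\<close>

lemma powers_bounded_recurrence: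
  fixes A :: "'p::topological_space \<Rightarrow> real^'d^'d"
  assumes "compact P" "continuous_on P A"
  obtains C where "C \<ge> 0" and "\<And>\<alpha>. \<alpha> \<in> P \<Longrightarrow> \<exists>c. (\<forall>k<CARD('d). \<bar>c k\<bar> \<le> C) \<and>
      (\<forall>v n. ((*v) (A \<alpha>) ^^ (n + CARD('d))) v = (\<Sum>k<CARD('d). c k *\<^sub>R ((*v) (A \<alpha>) ^^ (n + k)) v))"
proof -
  let ?d = "CARD('d)"
  have "\<exists>C. \<forall>\<alpha>\<in>P. \<bar>coeff (det (char_mat (A \<alpha>))) k\<bar> \<le> C" for k
    using compact_imp_bounded[OF compact_continuous_image[OF continuous_char_poly_coeff[OF assms(2)] assms(1)]]
    by (auto simp: bounded_iff)
  then obtain B where B: "\<And>k \<alpha>. \<alpha> \<in> P \<Longrightarrow> \<bar>coeff (det (char_mat (A \<alpha>))) k\<bar> \<le> B k"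
    by metis
  define C where "C = (\<Sum>k<?d. \<bar>B k\<bar>)"
  show thesis
  proof
    show "C \<ge> 0" by (simp add: C_def sum_nonneg)
    fix \<alpha> assume \<alpha>: "\<alpha> \<in> P"
    let ?L = "(*v) (A \<alpha>)" and ?q = "det (char_mat (A \<alpha>))"
    define c where "c k = - coeff ?q k" for k
    have "\<bar>c k\<bar> \<le> C" if "k < ?d" for k
    proof -
      have "\<bar>B k\<bar> \<le> C" unfolding C_def by (rule member_le_sum) (use that in auto)
      with B[OF \<alpha>, of k] show ?thesis by (simp add: c_def)
    qed
    moreover have "(?L ^^ (n + ?d)) v = (\<Sum>k<?d. c k *\<^sub>R (?L ^^ (n + k)) v)" for v n
    proof -
      have 0: "0 = (\<Sum>k\<le>?d. coeff ?q k *\<^sub>R (?L ^^ k) v)"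
        using cayley_hamilton[of "A \<alpha>" v] poly_act_bound[OF char_poly_monic(1)[of "A \<alpha>"]] by metis
      have "\<dots> = (\<Sum>k<?d. coeff ?q k *\<^sub>R (?L ^^ k) v) + (?L ^^ ?d) v"
        by (simp add: lessThan_Suc_atMost[symmetric] char_poly_monic(2))
      then have "(?L ^^ ?d) v = (\<Sum>k<?d. c k *\<^sub>R (?L ^^ k) v)"
        using 0 by (simp add: c_def sum_negf add_eq_0_iff)
      then have "(?L ^^ n) ((?L ^^ ?d) v) = (\<Sum>k<?d. c k *\<^sub>R (?L ^^ n) ((?L ^^ k) v))"
        using linear_funpow[of ?L n] by (simp add: linear_sum linear_scale)
      then show ?thesis by (simp add: funpow_add)
    qed
    ultimately show "\<exists>c. (\<forall>k<?d. \<bar>c k\<bar> \<le> C) \<and>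
      (\<forall>v n. (?L ^^ (n + ?d)) v = (\<Sum>k<?d. c k *\<^sub>R (?L ^^ (n + k)) v))"
      by blast
  qed
qed

text \<open>
A sequence with such a recurrence is determined by its first \<open>N\<close> terms; each step of the
recurrence costs at most a factor \<open>K\<close>.
\<close>

lemma recurrence_growth:
  fixes F :: "nat \<Rightarrow> real"
  assumes rec: "\<And>n. F (n + N) = (\<Sum>k<N. c k * F (n + k))"
    and c: "\<And>k. k < N \<Longrightarrow> \<bar>c k\<bar> \<le> C" and K: "K \<ge> 1" "K \<ge> real N * C" and "C \<ge> 0"
  shows "\<bar>F n\<bar> \<le> K ^ n * (\<Sum>k<N. \<bar>F k\<bar>)"
proof (induction n rule: less_induct)
  case (less n)
  let ?Z = "\<Sum>k<N. \<bar>F k\<bar>"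
  have Z: "?Z \<ge> 0" by (simp add: sum_nonneg)
  show ?case
  proof (cases "n < N")
    case True
    then have "\<bar>F n\<bar> \<le> ?Z" by (intro member_le_sum) auto
    also have "\<dots> \<le> K ^ n * ?Z" using mult_right_mono[OF one_le_power[OF K(1), of n] Z] by simp
    finally show ?thesis .
  next
    case False
    define m where "m = n - N"
    have n: "n = m + N" using False by (simp add: m_def)
    show ?thesis
    proof (cases "N = 0")
      case True
      then show ?thesis using rec[of n] by simp
    next
      case N: False
      have "\<bar>F n\<bar> \<le> (\<Sum>k<N. \<bar>c k * F (m + k)\<bar>)"
        unfolding n rec by (rule sum_abs)
      also have "\<dots> \<le> (\<Sum>k<N. C * (K ^ (n - 1) * ?Z))"
      proof (rule sum_mono)
        fix k assume k: "k \<in> {..<N}"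
        have "\<bar>F (m + k)\<bar> \<le> K ^ (m + k) * ?Z" using less[of "m + k"] k n by simp
        also have "\<dots> \<le> K ^ (n - 1) * ?Z"
          using K k n Z by (intro mult_right_mono power_increasing) auto
        finally show "\<bar>c k * F (m + k)\<bar> \<le> C * (K ^ (n - 1) * ?Z)"
          unfolding abs_mult using c k by (intro mult_mono) (use \<open>C \<ge> 0\<close> in auto)
      qed
      also have "\<dots> = (real N * C) * (K ^ (n - 1) * ?Z)" by simp
      also have "\<dots> \<le> K * (K ^ (n - 1) * ?Z)"
        using K Z by (intro mult_right_mono) auto
      also have "\<dots> = K ^ n * ?Z" using N n by (simp add: power_eq_if)
      finally show ?thesis .
    qed
  qed
qed

section \<open>Taylor coefficients from samples\<close>

text \<open>
The inverse of the Vandermonde matrix at the nodes \<open>0, \<dots>, N - 1\<close>: \<open>W k j\<close> is the \<open>k\<close>-th coefficient of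
the \<open>j\<close>-th Lagrange polynomial, since \<open>\<Sum>j. j\<^sup>i l\<^sub>j\<close> interpolates \<open>x\<^sup>i\<close>.
\<close>

lemma vandermonde_weights:
  obtains W :: "nat \<Rightarrow> nat \<Rightarrow> real" where
    "\<And>k i. k < N \<Longrightarrow> i < N \<Longrightarrow> (\<Sum>j<N. W k j * real j ^ i) = (if k = i then 1 else 0)"
proof -
  define l :: "nat \<Rightarrow> real poly" where
    "l j = smult (1 / (\<Prod>i\<in>{..<N}-{j}. real j - real i)) (\<Prod>i\<in>{..<N}-{j}. [:- real i, 1:])" for j
  have deg: "degree (l j) < N" if "j < N" for j
  proof -
    have "degree (l j) \<le> degree (\<Prod>i\<in>{..<N}-{j}. [:- real i, 1:])"
      unfolding l_def by (rule degree_smult_le)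
    also have "\<dots> \<le> (\<Sum>i\<in>{..<N}-{j}. 1)"
      by (rule order_trans[OF degree_prod_sum_le]) auto
    also have "\<dots> < N" using that by simp
    finally show ?thesis .
  qed
  have val: "poly (l j) (real m) = (if j = m then 1 else 0)" if "j < N" "m < N" for j m
  proof (cases "j = m")
    case True
    have "(\<Prod>i\<in>{..<N}-{m}. real m - real i) \<noteq> 0" by (auto simp: prod_zero_iff)
    then show ?thesis using True by (simp add: l_def poly_prod)
  next
    case False
    then have "(\<Prod>i\<in>{..<N}-{j}. real m - real i) = 0" using that by (auto simp: prod_zero_iff)
    then show ?thesis using False by (simp add: l_def poly_prod)
  qed
  show thesis
  proof
    fix k i assume k: "k < N" and i: "i < N"
    let ?q = "\<Sum>j<N. smult (real j ^ i) (l j)"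
    have "?q = monom 1 i"
    proof (rule poly_eqI_degree[of "real ` {..<N}"])
      fix x assume "x \<in> real ` {..<N}"
      then obtain m where m: "m < N" "x = real m" by auto
      have "poly ?q x = (\<Sum>j<N. if j = m then real m ^ i else 0)"
        unfolding poly_sum m(2) by (intro sum.cong) (use val m in auto)
      then show "poly ?q x = poly (monom 1 i) x" using m by (simp add: poly_monom)
    next
      have "degree ?q \<le> N - 1"
        using deg by (intro degree_sum_le) (auto intro!: order_trans[OF degree_smult_le] simp: Suc_leI less_Suc_eq_le[symmetric])
      then show "degree ?q < card (real ` {..<N})"
        using i by (simp add: card_image)
    next
      show "degree (monom (1::real) i) < card (real ` {..<N})"
        using i by (simp add: card_image degree_monom_eq)
    qed
    then have "coeff ?q k = coeff (monom 1 i) k" by simp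
    then show "(\<Sum>j<N. coeff (l j) k * real j ^ i) = (if k = i then 1 else 0)"
      by (simp add: coeff_sum mult.commute)
  qed
qed

lemma exp_majorant_summable:
  fixes F :: "nat \<Rightarrow> real"
  assumes "\<And>n. \<bar>F n\<bar> \<le> K ^ n * Z"
  shows "summable (\<lambda>n. norm (x ^ n / fact n * F n))"
proof (rule summable_comparison_test')
  have "summable (\<lambda>n. (K * \<bar>x\<bar>) ^ n /\<^sub>R fact n * Z)"
    by (intro summable_mult2 summable_exp_generic)
  then show "summable (\<lambda>n. \<bar>x\<bar> ^ n / fact n * (K ^ n * Z))"
    by (simp add: power_mult_distrib field_simps)
  fix n :: nat
  show "norm (norm (x ^ n / fact n * F n)) \<le> \<bar>x\<bar> ^ n / fact n * (K ^ n * Z)"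
    using assms[of n] by (auto simp: abs_mult power_abs intro!: mult_left_mono divide_right_mono)
qed

lemma exp_majorant_tail:
  fixes F :: "nat \<Rightarrow> real"
  assumes F: "\<And>n. \<bar>F n\<bar> \<le> K ^ n * Z" and K: "K \<ge> 0" and x: "x \<ge> 0" and Z: "Z \<ge> 0"
  shows "\<bar>(\<Sum>n. x ^ n / fact n * F n) - (\<Sum>n<N. x ^ n / fact n * F n)\<bar> \<le> (K * x) ^ N * exp (K * x) * Z"
proof -
  note s = exp_majorant_summable[of F K Z x, OF F]
  have "(\<Sum>n. x ^ n / fact n * F n) - (\<Sum>n<N. x ^ n / fact n * F n) = (\<Sum>n. x ^ (n+N) / fact (n+N) * F (n+N))"
    by (rule suminf_minus_initial_segment[symmetric, OF summable_norm_cancel[OF s]])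
  also have "\<bar>\<dots>\<bar> \<le> (\<Sum>n. \<bar>x ^ (n+N) / fact (n+N) * F (n+N)\<bar>)"
    using s[THEN summable_ignore_initial_segment, of N] by (intro summable_rabs) simp
  also have "\<dots> \<le> (\<Sum>n. (K * x) ^ N * Z * ((K * x) ^ n /\<^sub>R fact n))"
  proof (rule suminf_le)
    fix n :: nat
    have "\<bar>x ^ (n+N) / fact (n+N) * F (n+N)\<bar> = x ^ (n+N) / fact (n+N) * \<bar>F (n+N)\<bar>"
      using x by (simp add: abs_mult)
    also have "\<dots> \<le> x ^ (n+N) / fact n * (K ^ (n+N) * Z)"
      using x F[of "n+N"] by (intro mult_mono divide_left_mono fact_mono) auto
    also have "\<dots> = (K * x) ^ N * Z * ((K * x) ^ n /\<^sub>R fact n)"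
      by (simp add: power_mult_distrib power_add field_simps)
    finally show "\<bar>x ^ (n+N) / fact (n+N) * F (n+N)\<bar> \<le> (K * x) ^ N * Z * ((K * x) ^ n /\<^sub>R fact n)" .
  next
    show "summable (\<lambda>n. \<bar>x ^ (n+N) / fact (n+N) * F (n+N)\<bar>)"
      using s[THEN summable_ignore_initial_segment, of N] by simp
    show "summable (\<lambda>n. (K * x) ^ N * Z * ((K * x) ^ n /\<^sub>R fact n))"
      by (intro summable_mult summable_exp_generic)
  qed
  also have "\<dots> = (K * x) ^ N * Z * exp (K * x)"
    unfolding exp_def by (rule suminf_mult[OF summable_exp_generic])
  finally show ?thesis by (simp add: mult_ac)
qed

text \<open>
Up to a remainder of order \<open>h\<^sup>N\<close>, the samples of \<open>\<Sum>n. s\<^sup>n F\<^sub>n / n!\<close> at \<open>s = 0, h, \<dots>, (N - 1) h\<close> are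
a Vandermonde system for \<open>h\<^sup>k F\<^sub>k / k!\<close> with \<open>k < N\<close>. Solving it divides the remainder by at most
\<open>h\<^sup>N\<^sup>-\<^sup>1\<close>, up to constants, so what is left is a multiple of \<open>h\<close> times \<open>\<Sum>k<N. \<bar>F\<^sub>k\<bar>\<close>; for small \<open>h\<close>, chosen in terms of \<open>K\<close>,
\<open>N\<close> and \<open>T\<close> only, it is absorbed into the left-hand side. The bound is thus uniform over all sequences with
the given growth.
\<close>

lemma coefficients_bounded_by_samples:
  fixes K T :: real and N :: nat
  assumes K: "K \<ge> 1" and T: "T > 0" and N: "N > 0"
  shows "\<exists>h C. h > 0 \<and> real N * h \<le> T \<and> C \<ge> 0 \<and>
    (\<forall>F :: nat \<Rightarrow> real. (\<forall>n. \<bar>F n\<bar> \<le> K ^ n * (\<Sum>k<N. \<bar>F k\<bar>)) \<longrightarrow>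
      (\<Sum>k<N. \<bar>F k\<bar>) \<le> C * (\<Sum>j<N. \<bar>\<Sum>n. (real j * h) ^ n / fact n * F n\<bar>))"
proof -
  obtain W :: "nat \<Rightarrow> nat \<Rightarrow> real" where
    W: "\<And>k i. k < N \<Longrightarrow> i < N \<Longrightarrow> (\<Sum>j<N. W k j * real j ^ i) = (if k = i then 1 else 0)"
    using vandermonde_weights[of N] by blast
  define w where "w = (\<Sum>k<N. \<Sum>j<N. \<bar>W k j\<bar>)"
  have w0: "w \<ge> 0" by (simp add: w_def sum_nonneg)
  have w: "\<bar>W k j\<bar> \<le> w" if "k < N" "j < N" for k j
  proof -
    have "\<bar>W k j\<bar> \<le> (\<Sum>j<N. \<bar>W k j\<bar>)" using that by (intro member_le_sum) auto
    also have "\<dots> \<le> w" unfolding w_def using that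
      by (intro member_le_sum[of k "{..<N}" "\<lambda>k. \<Sum>j<N. \<bar>W k j\<bar>"]) (auto simp: sum_nonneg)
    finally show ?thesis .
  qed
  define D where "D = (K * real N) ^ N * exp (K * real N)"
  have D0: "D \<ge> 0" using K by (simp add: D_def)
  define B where "B = real N * (fact N * w)"
  have B0: "B \<ge> 0" using w0 by (simp add: B_def)
  \<comment> \<open>The last bound makes the absorbed term at most half of the left-hand side.\<close>
  define h where "h = min 1 (min (T / real N) (1 / (2 * (B * real N * D + 1))))"
  have pos: "B * real N * D + 1 > 0" using B0 D0 by (intro add_nonneg_pos mult_nonneg_nonneg) auto
  have h: "h > 0" "h \<le> 1" "h \<le> T / real N" "h \<le> 1 / (2 * (B * real N * D + 1))"
    using T N pos by (auto simp: h_def)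
  define C where "C = 2 * (B / h ^ N)"
  show ?thesis
  proof (rule exI[of _ h], rule exI[of _ C], intro conjI allI impI)
    show "h > 0" "real N * h \<le> T" "C \<ge> 0" using h N B0 by (auto simp: C_def field_simps)
    fix F :: "nat \<Rightarrow> real"
    define Z where "Z = (\<Sum>k<N. \<bar>F k\<bar>)"
    define f where "f j = (\<Sum>n. (real j * h) ^ n / fact n * F n)" for j
    define S where "S = (\<Sum>j<N. \<bar>f j\<bar>)"
    assume "\<forall>n. \<bar>F n\<bar> \<le> K ^ n * (\<Sum>k<N. \<bar>F k\<bar>)"
    then have F: "\<And>n. \<bar>F n\<bar> \<le> K ^ n * Z" by (simp add: Z_def)
    have Z: "Z \<ge> 0" and S: "S \<ge> 0" by (simp_all add: Z_def S_def sum_nonneg)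
    define R where "R j = f j - (\<Sum>n<N. (real j * h) ^ n / fact n * F n)" for j
    have R: "\<bar>R j\<bar> \<le> h ^ N * D * Z" if "j < N" for j
    proof -
      have "\<bar>R j\<bar> \<le> (K * (real j * h)) ^ N * exp (K * (real j * h)) * Z"
        unfolding R_def f_def by (rule exp_majorant_tail) (use F K h Z in auto)
      also have "\<dots> \<le> ((K * real N) * h) ^ N * exp (K * real N) * Z"
      proof (rule mult_right_mono[OF mult_mono[OF power_mono]])
        have j: "real j * h \<le> real N * h" using that h by simp
        then show "K * (real j * h) \<le> K * real N * h" using K by (simp add: mult.assoc)
        have "real N * h \<le> real N" using h by (simp add: mult_left_le)
        then have "K * (real j * h) \<le> K * real N" using j K by (intro mult_left_mono) auto
        then show "exp (K * (real j * h)) \<le> exp (K * real N)" by simp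
      qed (use K h Z in auto)
      also have "\<dots> = h ^ N * D * Z" by (simp only: D_def power_mult_distrib mult_ac)
      finally show ?thesis .
    qed
    \<comment> \<open>The Vandermonde weights isolate a single coefficient; the remainder loses a factor \<open>h\<^sup>k\<close> only.\<close>
    have Fk: "\<bar>F k\<bar> \<le> fact N * w / h ^ N * S + fact N * w * real N * h * D * Z" if k: "k < N" for k
    proof -
      have "(\<Sum>j<N. W k j * (f j - R j)) = (\<Sum>j<N. \<Sum>n<N. W k j * real j ^ n * (h ^ n / fact n * F n))"
        by (simp add: R_def f_def sum_distrib_left power_mult_distrib mult_ac)
      also have "\<dots> = (\<Sum>n<N. (\<Sum>j<N. W k j * real j ^ n) * (h ^ n / fact n * F n))"
        by (subst sum.swap) (simp only: sum_distrib_right)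
      also have "\<dots> = (\<Sum>n<N. if k = n then h ^ n / fact n * F n else 0)"
        by (intro sum.cong) (auto simp: W k)
      also have "\<dots> = h ^ k / fact k * F k" using k by simp
      finally have e: "h ^ k / fact k * F k = (\<Sum>j<N. W k j * (f j - R j))" by simp
      have "\<bar>h ^ k / fact k * F k\<bar> \<le> (\<Sum>j<N. \<bar>W k j * (f j - R j)\<bar>)"
        unfolding e by (rule sum_abs)
      also have "\<dots> \<le> (\<Sum>j<N. w * (\<bar>f j\<bar> + h ^ N * D * Z))"
      proof (rule sum_mono)
        fix j assume j: "j \<in> {..<N}"
        have "\<bar>f j - R j\<bar> \<le> \<bar>f j\<bar> + \<bar>R j\<bar>" by (rule abs_triangle_ineq4)
        then have "\<bar>f j - R j\<bar> \<le> \<bar>f j\<bar> + h ^ N * D * Z" using R[of j] j by simp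
        then show "\<bar>W k j * (f j - R j)\<bar> \<le> w * (\<bar>f j\<bar> + h ^ N * D * Z)"
          unfolding abs_mult using w[OF k, of j] j w0 by (intro mult_mono) auto
      qed
      also have "\<dots> = w * S + w * real N * h ^ N * D * Z"
        by (simp add: S_def distrib_left sum.distrib sum_distrib_left[symmetric])
      finally have 1: "h ^ k / fact k * \<bar>F k\<bar> \<le> w * S + w * real N * h ^ N * D * Z"
        using h by (simp add: abs_mult)
      have "\<bar>F k\<bar> = fact k / h ^ k * (h ^ k / fact k * \<bar>F k\<bar>)" using h by simp
      also have "\<dots> \<le> fact k / h ^ k * (w * S + w * real N * h ^ N * D * Z)"
        using 1 h by (intro mult_left_mono) auto
      also have "\<dots> = fact k * w * S * (1 / h ^ k) + fact k * w * real N * D * Z * (h ^ N / h ^ k)"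
        by (simp only: divide_inverse mult_1_left) (simp only: algebra_simps)
      also have "\<dots> \<le> fact N * w * S * (1 / h ^ N) + fact N * w * real N * D * Z * h"
      proof (intro add_mono mult_mono)
        show "fact k \<le> (fact N :: real)" using k by (intro fact_mono) auto
        then show "fact k \<le> (fact N :: real)" .
        show "1 / h ^ k \<le> 1 / h ^ N"
          using h k by (intro divide_left_mono power_decreasing) auto
        have "h ^ N / h ^ k = h ^ (N - k)" using h k by (simp add: power_diff)
        also have "\<dots> \<le> h ^ 1" using h k by (intro power_decreasing) auto
        finally show "h ^ N / h ^ k \<le> h" by simp
      qed (use w0 D0 Z S h in \<open>auto intro!: mult_nonneg_nonneg\<close>)
      finally show ?thesis by (simp add: mult_ac)
    qed
    have "Z \<le> (\<Sum>k<N. fact N * w / h ^ N * S + fact N * w * real N * h * D * Z)"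
      unfolding Z_def[symmetric] by (subst Z_def, rule sum_mono) (use Fk in auto)
    also have "\<dots> = B / h ^ N * S + (B * real N * D * h) * Z"
      by (simp add: B_def algebra_simps)
    also have "\<dots> \<le> B / h ^ N * S + 1/2 * Z"
    proof (intro add_left_mono mult_right_mono Z)
      have "B * real N * D * h \<le> (B * real N * D + 1) * h" using h by (simp add: algebra_simps)
      also have "\<dots> \<le> (B * real N * D + 1) * (1 / (2 * (B * real N * D + 1)))"
        using h pos by (intro mult_left_mono) auto
      also have "\<dots> = 1 / 2" using pos by simp
      finally show "B * real N * D * h \<le> 1/2" .
    qed
    finally have "Z \<le> C * S" by (simp add: C_def)
    then show "(\<Sum>k<N. \<bar>F k\<bar>) \<le> C * (\<Sum>j<N. \<bar>\<Sum>n. (real j * h) ^ n / fact n * F n\<bar>)"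
      by (simp only: Z_def S_def f_def)
  qed
qed

text \<open>
Identity theorem for a real series with coefficients of exponential type. It extends to an entire
function on the complex plane, and an infinite bounded set of solutions of \<open>g(x) = a\<close> accumulates.
\<close>

lemma entire_series_coeffs_zero:
  fixes c :: "nat \<Rightarrow> real"
  assumes c: "\<And>n. \<bar>c n\<bar> \<le> K ^ n * M"
    and X: "infinite X" "bounded X"
    and zero: "\<And>x. x \<in> X \<Longrightarrow> (\<Sum>n. x ^ n / fact n * c n) = a"
  shows "\<And>n. n > 0 \<Longrightarrow> c n = 0" and "c 0 = a"
proof -
  define e where "e n = complex_of_real (c n / fact n - (if n = 0 then a else 0))" for n
  have sum_e: "summable (\<lambda>n. x ^ n / fact n * c n - (if n = 0 then a else 0))" for x :: real
    by (intro summable_diff summable_norm_cancel[OF exp_majorant_summable[of c K M x, OF c]])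
      (rule summable_finite[of "{0}"], auto)
  have e_of_real: "e n * complex_of_real x ^ n = complex_of_real (x ^ n / fact n * c n - (if n = 0 then a else 0))" for n x
    by (simp add: e_def)
  have summ: "summable (\<lambda>n. e n * z ^ n)" for z
  proof (rule powser_inside)
    show "summable (\<lambda>n. e n * complex_of_real (norm z + 1) ^ n)"
      unfolding e_of_real using sum_e by (simp only: summable_of_real)
    show "norm z < norm (complex_of_real (norm z + 1))" by (simp add: norm_of_real del: of_real_add)
  qed
  define g where "g z = (\<Sum>n. e n * z ^ n)" for z
  have sg: "(\<lambda>n. e n * z ^ n) sums g z" for z
    unfolding g_def using summ by (rule summable_sums)
  have hol: "g holomorphic_on UNIV"
  proof (rule holomorphic_onI)
    fix z
    have "(\<lambda>z. \<Sum>n. e n * z ^ n) field_differentiable at z"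
      using termdiffs_strong_converges_everywhere[of e z] summ field_differentiable_def by blast
    then show "g field_differentiable at z within UNIV"
      unfolding g_def by simp
  qed
  define U where "U = complex_of_real ` X"
  have "infinite U" unfolding U_def using X(1) by (simp add: finite_image_iff inj_on_def)
  moreover have "bounded U" unfolding U_def using X(2)
    by (metis bounded_linear_image bounded_linear_of_real)
  ultimately obtain \<xi> where "\<xi> islimpt U"
    using bounded_closure[of U] compact_closure[of U] by (metis Heine_Borel_imp_Bolzano_Weierstrass bounded_closure closed_closure closure_subset compact_eq_bounded_closed)
  moreover have "g z = 0" if "z \<in> U" for z
  proof -
    from that obtain x where x: "x \<in> X" "z = complex_of_real x" by (auto simp: U_def)
    have "(\<lambda>n. x ^ n / fact n * c n) sums a"
      using zero[OF x(1)] summable_sums[OF summable_norm_cancel[OF exp_majorant_summable[of c K M x, OF c]]] by simp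
    moreover have "(\<lambda>n. if n = 0 then a else 0) sums a"
      using sums_finite[of "{0}" "\<lambda>n. if n = 0 then a else 0"] by simp
    ultimately have "(\<lambda>n. x ^ n / fact n * c n - (if n = 0 then a else 0)) sums 0"
      using sums_diff by fastforce
    then have "(\<lambda>n. e n * z ^ n) sums 0"
      unfolding x(2) e_of_real using sums_of_real[where 'a=complex] by fastforce
    with sg show ?thesis using sums_unique2 by blast
  qed
  ultimately have g0: "g z = 0" for z
    using analytic_continuation[OF hol open_UNIV connected_UNIV, of U \<xi> z] by auto
  have e0: "e n = 0" for n
  proof (rule ccontr)
    assume "e n \<noteq> 0"
    define f where "f = Abs_fps e"
    have "f = 0"
    proof (rule eval_fps_eqD)
      have "conv_radius e = \<infinity>"
        using conv_radius_geI_ex'[of \<infinity> e] summ by auto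
      then show "fps_conv_radius f > 0" by (simp add: f_def fps_conv_radius_def)
      show "fps_conv_radius (0::complex fps) > 0" by simp
      show "eventually (\<lambda>z. eval_fps f z = eval_fps 0 z) (nhds 0)"
        using g0 by (simp add: eval_fps_def f_def g_def)
    qed
    then have "fps_nth f n = 0" by simp
    with \<open>e n \<noteq> 0\<close> show False by (simp add: f_def)
  qed
  show "c n = 0" if "n > 0" for n
    using e0[of n] that by (simp add: e_def)
  show "c 0 = a"
    using e0[of 0] by (simp add: e_def)
qed

section \<open>Linear integral equations\<close>

lemma norm_matrix_vector_le:
  fixes M :: "real^'d^'d"
  shows "norm (M *v x) \<le> (real CARD('d) * norm M) * norm x"
proof -
  have "norm (M *v x) \<le> (\<Sum>i\<in>UNIV. \<bar>(M *v x) $ i\<bar>)" by (rule norm_le_l1_cart)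
  also have "\<dots> \<le> (\<Sum>i\<in>(UNIV::'d set). norm M * norm x)"
  proof (rule sum_mono)
    fix i
    have "(M *v x) $ i = (M $ i) \<bullet> x" by (simp add: matrix_vector_mul_component)
    then have "\<bar>(M *v x) $ i\<bar> \<le> norm (M $ i) * norm x" by (simp add: Cauchy_Schwarz_ineq2)
    also have "\<dots> \<le> norm M * norm x" by (intro mult_right_mono Finite_Cartesian_Product.norm_nth_le) auto
    finally show "\<bar>(M *v x) $ i\<bar> \<le> norm M * norm x" .
  qed
  finally show ?thesis by simp
qed

lemma norm_funpow_le:
  fixes L :: "'v::real_normed_vector \<Rightarrow> 'v"
  assumes "\<And>x. norm (L x) \<le> K * norm x" "K \<ge> 0"
  shows "norm ((L ^^ k) x) \<le> K ^ k * norm x"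
proof (induction k)
  case (Suc k)
  have "norm ((L ^^ Suc k) x) \<le> K * norm ((L ^^ k) x)" using assms(1) by simp
  also have "\<dots> \<le> K * (K ^ k * norm x)" using Suc assms(2) by (intro mult_left_mono)
  finally show ?case by (simp add: mult_ac)
qed simp

lemma has_integral_exp_term:
  fixes t :: real
  assumes "t \<ge> 0"
  shows "((\<lambda>s. s ^ n / fact n) has_integral t ^ Suc n / fact (Suc n)) {0..t}"
proof -
  have "((\<lambda>s. s ^ n / fact n) has_integral (t ^ Suc n / fact (Suc n) - 0 ^ Suc n / fact (Suc n))) {0..t}"
  proof (rule fundamental_theorem_of_calculus[OF assms])
    fix s :: real
    have "((\<lambda>s. s ^ Suc n / fact (Suc n)) has_real_derivative (of_nat (Suc n) * s ^ n) / fact (Suc n)) (at s within {0..t})"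
      by (intro derivative_eq_intros) auto
    moreover have "(of_nat (Suc n) * s ^ n) / fact (Suc n) = s ^ n / fact n"
      by (simp add: fact_Suc del: of_nat_Suc)
    ultimately show "((\<lambda>s. s ^ Suc n / fact (Suc n)) has_vector_derivative s ^ n / fact n) (at s within {0..t})"
      by (simp add: has_real_derivative_iff_has_vector_derivative)
  qed
  then show ?thesis by simp
qed

text \<open>
Iterated primitives of the control. They turn the convolution in the variation of constants formula
into a series, so that no matrix exponential is needed.
\<close>

primrec iter_integral :: "(real \<Rightarrow> real) \<Rightarrow> nat \<Rightarrow> real \<Rightarrow> real" where
  "iter_integral u 0 t = u t"
| "iter_integral u (Suc k) t = integral {0..t} (iter_integral u k)"

lemma iter_integral_integrable:
  assumes "u integrable_on {0..T}"
  shows "iter_integral u k integrable_on {0..T}" and "continuous_on {0..T} (iter_integral u (Suc k))"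
proof -
  show "iter_integral u k integrable_on {0..T}"
  proof (induction k)
    case 0
    then show ?case using assms by (simp add: iter_integral.simps(1)[abs_def])
  next
    case (Suc k)
    then have "continuous_on {0..T} (\<lambda>t. integral {0..t} (iter_integral u k))"
      by (rule indefinite_integral_continuous_1)
    then show ?case by (simp add: integrable_continuous_interval)
  qed
  then show "continuous_on {0..T} (iter_integral u (Suc k))"
    using indefinite_integral_continuous_1[of "iter_integral u k" 0 T] by simp
qed

lemma iter_integral_bound:
  assumes u: "u absolutely_integrable_on {0..T}" and t: "t \<in> {0..T}"
  shows "\<bar>iter_integral u (Suc k) t\<bar> \<le> t ^ k / fact k * integral {0..T} (\<lambda>s. \<bar>u s\<bar>)"
  using t
proof (induction k arbitrary: t)
  let ?M = "integral {0..T} (\<lambda>s. \<bar>u s\<bar>)"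
  have int: "u integrable_on {0..T}" "(\<lambda>s. \<bar>u s\<bar>) integrable_on {0..T}"
    using u by (auto simp: absolutely_integrable_on_def)
  case 0
  have sub: "{0..t} \<subseteq> {0..T}" using 0 by auto
  note int' = int[THEN integrable_on_subinterval, OF sub]
  have "\<bar>integral {0..t} u\<bar> \<le> integral {0..t} (\<lambda>s. \<bar>u s\<bar>)"
    using integral_norm_bound_integral[OF int'] by simp
  also have "\<dots> \<le> ?M"
    by (rule integral_subset_le[OF sub int'(2) int(2)]) simp
  finally show ?case by (simp add: iter_integral.simps(1)[abs_def])
next
  let ?M = "integral {0..T} (\<lambda>s. \<bar>u s\<bar>)"
  have int: "u integrable_on {0..T}" using u by (auto simp: absolutely_integrable_on_def)
  case (Suc k)
  have sub: "{0..t} \<subseteq> {0..T}" using Suc.prems by auto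
  have h: "((\<lambda>s. s ^ k / fact k * ?M) has_integral t ^ Suc k / fact (Suc k) * ?M) {0..t}"
    by (intro has_integral_mult_left has_integral_exp_term) (use Suc.prems in auto)
  have "\<bar>integral {0..t} (iter_integral u (Suc k))\<bar> \<le> integral {0..t} (\<lambda>s. s ^ k / fact k * ?M)"
    using integral_norm_bound_integral[of "iter_integral u (Suc k)" "{0..t}" "\<lambda>s. s ^ k / fact k * ?M"]
      integrable_on_subinterval[OF iter_integral_integrable(1)[OF int] sub] h Suc.IH Suc.prems
    by (auto simp: has_integral_integrable)
  also have "\<dots> = t ^ Suc k / fact (Suc k) * ?M"
    using h by (rule integral_unique)
  finally show ?case by simp
qed

lemma linear_bound:
  fixes L :: "'v::euclidean_space \<Rightarrow> 'v"
  assumes "linear L"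
  shows "\<exists>K>0. \<forall>x. norm (L x) \<le> K * norm x"
  using linear_bounded_pos[OF assms] by (metis (no_types))

text \<open>
Iterating the homogeneous equation \<open>n\<close> times bounds \<open>D\<close> by a multiple of \<open>(K t)\<^sup>n / n!\<close>.
\<close>

lemma linear_integral_eq_unique:
  fixes L :: "'v::euclidean_space \<Rightarrow> 'v" and D :: "real \<Rightarrow> 'v"
  assumes L: "linear L" and cont: "continuous_on {0..T} D"
    and eq: "\<And>t. t \<in> {0..T} \<Longrightarrow> D t = integral {0..t} (\<lambda>s. L (D s))" and t: "t \<in> {0..T}"
  shows "D t = 0"
proof -
  obtain K where K: "K > 0" "\<And>x. norm (L x) \<le> K * norm x"
    using linear_bound[OF L] by metis
  obtain M where M: "\<And>s. s \<in> {0..T} \<Longrightarrow> norm (D s) \<le> M"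
    using compact_imp_bounded[OF compact_continuous_image[OF cont compact_Icc]]
    unfolding bounded_iff by blast
  have cLD: "continuous_on {0..T} (\<lambda>s. L (D s))"
    using linear_continuous_on_compose[OF cont] L by blast
  have bound: "norm (D t) \<le> M * K ^ n * (t ^ n / fact n)" if "t \<in> {0..T}" for t n
    using that
  proof (induction n arbitrary: t)
    case 0
    then show ?case using M by simp
  next
    case (Suc n)
    have h: "((\<lambda>s. M * K ^ Suc n * (s ^ n / fact n)) has_integral M * K ^ Suc n * (t ^ Suc n / fact (Suc n))) {0..t}"
      by (intro has_integral_mult_right has_integral_exp_term) (use Suc.prems in auto)
    have "norm (integral {0..t} (\<lambda>s. L (D s))) \<le> integral {0..t} (\<lambda>s. M * K ^ Suc n * (s ^ n / fact n))"
    proof (rule integral_norm_bound_integral)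
      show "(\<lambda>s. L (D s)) integrable_on {0..t}"
        using continuous_on_subset[OF cLD] Suc.prems by (intro integrable_continuous_interval) auto
      show "(\<lambda>s. M * K ^ Suc n * (s ^ n / fact n)) integrable_on {0..t}"
        using h by (rule has_integral_integrable)
      fix s assume s: "s \<in> {0..t}"
      have "norm (L (D s)) \<le> K * norm (D s)" by (rule K)
      also have "\<dots> \<le> K * (M * K ^ n * (s ^ n / fact n))"
        using Suc.IH[of s] s Suc.prems K by (intro mult_left_mono) auto
      finally show "norm (L (D s)) \<le> M * K ^ Suc n * (s ^ n / fact n)" by (simp add: mult_ac)
    qed
    then show ?case using eq[OF Suc.prems] integral_unique[OF h] by simp
  qed
  have "(\<lambda>n. (K * t) ^ n /\<^sub>R fact n) \<longlonglongrightarrow> 0"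
    by (rule summable_LIMSEQ_zero[OF summable_exp_generic])
  then have "(\<lambda>n. M * ((K * t) ^ n /\<^sub>R fact n)) \<longlonglongrightarrow> M * 0"
    by (intro tendsto_intros)
  then have "(\<lambda>n. M * K ^ n * (t ^ n / fact n)) \<longlonglongrightarrow> 0"
    by (simp add: power_mult_distrib field_simps)
  then have "norm (D t) \<le> 0"
    by (rule LIMSEQ_le_const) (use bound[OF t] in auto)
  then show ?thesis by simp
qed

text \<open>
The variation of constants formula
\<open>exp(tL) x0 + \<integral>\<^sub>0\<^sup>t exp((t-s)L) b u(s) ds\<close>, with the exponentials expanded: the \<open>k\<close>-th term of the
second exponential integrates \<open>(t-s)\<^sup>k/k!\<close> against \<open>u\<close>, which is the \<open>(k+1)\<close>-fold primitive of \<open>u\<close>.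
\<close>

definition series_solution :: "('v::real_normed_vector \<Rightarrow> 'v) \<Rightarrow> 'v \<Rightarrow> 'v \<Rightarrow> (real \<Rightarrow> real) \<Rightarrow> real \<Rightarrow> 'v" where
  "series_solution L b x0 u t =
     (\<Sum>k. (L ^^ k) ((t ^ k / fact k) *\<^sub>R x0 + iter_integral u (Suc k) t *\<^sub>R b))"

text \<open>
The common majorant for convergence in time, continuity in the parameter and Lipschitz dependence
on the control.
\<close>

lemma series_term_bound:
  fixes L :: "'v::real_normed_vector \<Rightarrow> 'v"
  assumes K: "\<And>x. norm (L x) \<le> K * norm x" "K \<ge> 0"
    and u: "u absolutely_integrable_on {0..T}" and t: "t \<in> {0..T}"
  shows "norm ((L ^^ k) ((t ^ k / fact k) *\<^sub>R x0 + iter_integral u (Suc k) t *\<^sub>R b))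
    \<le> (K * T) ^ k /\<^sub>R fact k * (norm x0 + integral {0..T} (\<lambda>s. \<bar>u s\<bar>) * norm b)"
proof -
  let ?M = "integral {0..T} (\<lambda>s. \<bar>u s\<bar>)"
  have M: "?M \<ge> 0" by (rule integral_nonneg) (use u in \<open>auto simp: absolutely_integrable_on_def\<close>)
  have tT: "t ^ k / fact k \<le> T ^ k / fact k" using t by (intro divide_right_mono power_mono) auto
  have "norm ((t ^ k / fact k) *\<^sub>R x0 + iter_integral u (Suc k) t *\<^sub>R b)
      \<le> t ^ k / fact k * norm x0 + \<bar>iter_integral u (Suc k) t\<bar> * norm b"
    by (rule order_trans[OF norm_triangle_ineq]) (use t in simp)
  also have "\<dots> \<le> T ^ k / fact k * norm x0 + (T ^ k / fact k * ?M) * norm b"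
    using tT by (intro add_mono mult_right_mono order_trans[OF iter_integral_bound[OF u t]] M) auto
  finally have 1: "norm ((t ^ k / fact k) *\<^sub>R x0 + iter_integral u (Suc k) t *\<^sub>R b)
    \<le> T ^ k / fact k * (norm x0 + ?M * norm b)" by (simp add: algebra_simps)
  have "norm ((L ^^ k) ((t ^ k / fact k) *\<^sub>R x0 + iter_integral u (Suc k) t *\<^sub>R b))
      \<le> K ^ k * (T ^ k / fact k * (norm x0 + ?M * norm b))"
    by (rule order_trans[OF norm_funpow_le[OF K]]) (rule mult_left_mono[OF 1], use K in simp)
  also have "\<dots> = (K * T) ^ k /\<^sub>R fact k * (norm x0 + ?M * norm b)"
    by (simp add: power_mult_distrib divide_inverse)
  finally show ?thesis .
qed

text \<open>
Each term of the series is \<open>L\<close> applied to the primitive of the previous one, so the partial sums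
are the Picard iterates of the equation; uniform convergence allows passing to the limit.
\<close>

lemma series_solution_solves:
  fixes L :: "'v::euclidean_space \<Rightarrow> 'v" and x0 b :: 'v
  assumes L: "linear L" and u: "u absolutely_integrable_on {0..T}"
  defines "X \<equiv> series_solution L b x0 u"
  shows "continuous_on {0..T} X"
    and "\<And>t. t \<in> {0..T} \<Longrightarrow> X t = x0 + integral {0..t} (\<lambda>s. L (X s) + u s *\<^sub>R b)"
proof -
  obtain K where "K > 0" and K': "\<And>x. norm (L x) \<le> K * norm x"
    using linear_bound[OF L] by metis
  then have K: "K \<ge> 0" "\<And>x. norm (L x) \<le> K * norm x" by auto
  have int: "u integrable_on {0..T}" using u by (auto simp: absolutely_integrable_on_def)
  define g where "g k t = (L ^^ k) ((t ^ k / fact k) *\<^sub>R x0 + iter_integral u (Suc k) t *\<^sub>R b)" for k t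
  define S where "S n t = (\<Sum>k<n. g k t)" for n t
  have Lk: "linear (L ^^ k)" for k by (rule linear_funpow[OF L])
  have ug: "uniform_limit {0..T} S X sequentially"
    unfolding S_def X_def series_solution_def g_def
  proof (rule Weierstrass_m_test)
    show "summable (\<lambda>k. (K * T) ^ k /\<^sub>R fact k * (norm x0 + integral {0..T} (\<lambda>s. \<bar>u s\<bar>) * norm b))"
      by (intro summable_mult2 summable_exp_generic)
  qed (rule series_term_bound[OF K(2) K(1) u])
  have cg: "continuous_on {0..T} (g k)" for k
    unfolding g_def
    by (rule linear_continuous_on_compose[OF _ Lk])
      (intro continuous_intros iter_integral_integrable(2)[OF int]; simp)
  have cS: "continuous_on {0..T} (S n)" for n
    unfolding S_def by (intro continuous_intros cg)
  show cX: "continuous_on {0..T} X"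
    by (rule uniform_limit_theorem[OF _ ug]) (auto simp: cS)
  fix t assume t: "t \<in> {0..T}"
  have sub: "{0..t} \<subseteq> {0..T}" using t by auto
  have cSt: "continuous_on {0..t} (S n)" for n using cS sub by (rule continuous_on_subset)
  have cXt: "continuous_on {0..t} X" using cX sub by (rule continuous_on_subset)
  have bl: "bounded_linear L" using L by (rule linear_conv_bounded_linear[THEN iffD1])
  have g_step: "g (Suc k) t = L (integral {0..t} (g k))" for k
  proof -
    have i1: "((\<lambda>s. s ^ k / fact k) has_integral t ^ Suc k / fact (Suc k)) {0..t}"
      by (rule has_integral_exp_term) (use t in auto)
    have i2: "(iter_integral u (Suc k) has_integral iter_integral u (Suc (Suc k)) t) {0..t}"
      using integrable_integral[OF integrable_on_subinterval[OF iter_integral_integrable(1)[OF int, of "Suc k"] sub]]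
      by simp
    have "(g k has_integral (L ^^ k) ((t ^ Suc k / fact (Suc k)) *\<^sub>R x0 + iter_integral u (Suc (Suc k)) t *\<^sub>R b)) {0..t}"
      unfolding g_def
      by (rule has_integral_linear[OF _ linear_conv_bounded_linear[THEN iffD1, OF Lk], unfolded o_def])
        (intro has_integral_add has_integral_scaleR_left i1 i2)
    then have "L (integral {0..t} (g k)) = L ((L ^^ k) ((t ^ Suc k / fact (Suc k)) *\<^sub>R x0 + iter_integral u (Suc (Suc k)) t *\<^sub>R b))"
      by (simp add: integral_unique)
    then show ?thesis unfolding g_def by simp
  qed
  have S_step: "S (Suc n) t = x0 + integral {0..t} u *\<^sub>R b + L (integral {0..t} (S n))" for n
  proof -
    have "S (Suc n) t = g 0 t + (\<Sum>k<n. g (Suc k) t)"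
      unfolding S_def by (rule sum.lessThan_Suc_shift)
    also have "g 0 t = x0 + integral {0..t} u *\<^sub>R b"
      by (simp add: g_def iter_integral.simps(1)[abs_def])
    also have "(\<Sum>k<n. g (Suc k) t) = L (\<Sum>k<n. integral {0..t} (g k))"
      unfolding g_step using L by (simp add: linear_sum)
    also have "(\<Sum>k<n. integral {0..t} (g k)) = integral {0..t} (S n)"
      unfolding S_def using continuous_on_subset[OF cg sub]
      by (subst integral_sum) (auto intro: integrable_continuous_interval)
    finally show ?thesis .
  qed
  have "(\<lambda>n. integral {0..t} (S n)) \<longlonglongrightarrow> integral {0..t} X"
  proof -
    obtain I J where I: "\<And>n. (S n has_integral I n) {0..t}" and J: "(X has_integral J) {0..t}"
      and lim: "I \<longlonglongrightarrow> J"
      using uniform_limit_integral[OF uniform_limit_on_subset[OF ug sub]] cSt by (metis sequentially_bot)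
    have "I = (\<lambda>n. integral {0..t} (S n))" using integral_unique[OF I] by auto
    with J lim show ?thesis by (simp add: integral_unique)
  qed
  then have "(\<lambda>n. x0 + integral {0..t} u *\<^sub>R b + L (integral {0..t} (S n))) \<longlonglongrightarrow>
      x0 + integral {0..t} u *\<^sub>R b + L (integral {0..t} X)"
    by (intro tendsto_intros bounded_linear.tendsto[OF bl])
  then have "(\<lambda>n. S (Suc n) t) \<longlonglongrightarrow> x0 + integral {0..t} u *\<^sub>R b + L (integral {0..t} X)"
    by (simp add: S_step)
  moreover have "(\<lambda>n. S (Suc n) t) \<longlonglongrightarrow> X t"
    using tendsto_uniform_limitI[OF ug t] by (rule LIMSEQ_Suc)
  ultimately have "X t = x0 + integral {0..t} u *\<^sub>R b + L (integral {0..t} X)"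
    using LIMSEQ_unique by blast
  moreover have "((\<lambda>s. L (X s) + u s *\<^sub>R b) has_integral L (integral {0..t} X) + integral {0..t} u *\<^sub>R b) {0..t}"
    by (intro has_integral_add has_integral_scaleR_left has_integral_linear[OF _ bl, unfolded o_def]
        integrable_integral integrable_continuous_interval cXt integrable_on_subinterval[OF int sub])
  ultimately show "X t = x0 + integral {0..t} (\<lambda>s. L (X s) + u s *\<^sub>R b)"
    by (simp add: integral_unique add_ac)
qed

definition solves_integral_eq ::
  "('v::euclidean_space \<Rightarrow> 'v) \<Rightarrow> 'v \<Rightarrow> 'v \<Rightarrow> real \<Rightarrow> (real \<Rightarrow> real) \<Rightarrow> (real \<Rightarrow> 'v) \<Rightarrow> bool" where
  "solves_integral_eq L b x0 T u x \<longleftrightarrow> continuous_on {0..T} x \<and>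
     (\<forall>t\<in>{0..T}. x t = x0 + integral {0..t} (\<lambda>s. L (x s) + u s *\<^sub>R b))"

lemma solves_integral_eq_combination:
  fixes L :: "'v::euclidean_space \<Rightarrow> 'v"
  assumes L: "linear L" and u: "u integrable_on {0..T}" and w: "w integrable_on {0..T}"
    and x: "solves_integral_eq L b x0 T u x" and y: "solves_integral_eq L b y0 T w y"
  shows "solves_integral_eq L b (r *\<^sub>R x0 + s *\<^sub>R y0) T (\<lambda>t. r * u t + s * w t) (\<lambda>t. r *\<^sub>R x t + s *\<^sub>R y t)"
  unfolding solves_integral_eq_def
proof (intro conjI ballI)
  have bl: "bounded_linear L" using L by (rule linear_conv_bounded_linear[THEN iffD1])
  have c: "continuous_on {0..T} x" "continuous_on {0..T} y" using x y by (auto simp: solves_integral_eq_def)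
  show "continuous_on {0..T} (\<lambda>t. r *\<^sub>R x t + s *\<^sub>R y t)" by (intro continuous_intros c)
  fix t assume t: "t \<in> {0..T}"
  then have sub: "{0..t} \<subseteq> {0..T}" by auto
  have ix: "(\<lambda>s. L (x s) + u s *\<^sub>R b) integrable_on {0..t}"
    by (intro integrable_add integrable_continuous_interval linear_continuous_on_compose[OF _ L]
        continuous_on_subset[OF c(1) sub] integrable_on_scaleR_left integrable_on_subinterval[OF u sub])
  have iy: "(\<lambda>s. L (y s) + w s *\<^sub>R b) integrable_on {0..t}"
    by (intro integrable_add integrable_continuous_interval linear_continuous_on_compose[OF _ L]
        continuous_on_subset[OF c(2) sub] integrable_on_scaleR_left integrable_on_subinterval[OF w sub])
  have "((\<lambda>q. r *\<^sub>R (L (x q) + u q *\<^sub>R b) + s *\<^sub>R (L (y q) + w q *\<^sub>R b)) has_integral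
      r *\<^sub>R integral {0..t} (\<lambda>s. L (x s) + u s *\<^sub>R b) + s *\<^sub>R integral {0..t} (\<lambda>s. L (y s) + w s *\<^sub>R b)) {0..t}"
    by (intro has_integral_add has_integral_cmul integrable_integral ix iy)
  moreover have "(\<lambda>q. r *\<^sub>R (L (x q) + u q *\<^sub>R b) + s *\<^sub>R (L (y q) + w q *\<^sub>R b)) =
      (\<lambda>q. L (r *\<^sub>R x q + s *\<^sub>R y q) + (r * u q + s * w q) *\<^sub>R b)"
    using L by (simp add: fun_eq_iff linear_add linear_scale algebra_simps)
  ultimately have "integral {0..t} (\<lambda>q. L (r *\<^sub>R x q + s *\<^sub>R y q) + (r * u q + s * w q) *\<^sub>R b) =
     r *\<^sub>R integral {0..t} (\<lambda>s. L (x s) + u s *\<^sub>R b) + s *\<^sub>R integral {0..t} (\<lambda>s. L (y s) + w s *\<^sub>R b)"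
    by (simp add: integral_unique)
  moreover have "x t = x0 + integral {0..t} (\<lambda>s. L (x s) + u s *\<^sub>R b)"
    "y t = y0 + integral {0..t} (\<lambda>s. L (y s) + w s *\<^sub>R b)"
    using x y t by (auto simp: solves_integral_eq_def)
  ultimately show "r *\<^sub>R x t + s *\<^sub>R y t = r *\<^sub>R x0 + s *\<^sub>R y0 +
      integral {0..t} (\<lambda>q. L (r *\<^sub>R x q + s *\<^sub>R y q) + (r * u q + s * w q) *\<^sub>R b)"
    by (simp add: scaleR_add_right)
qed

lemma solves_integral_eq_unique:
  fixes L :: "'v::euclidean_space \<Rightarrow> 'v"
  assumes L: "linear L" and u: "u integrable_on {0..T}"
    and x: "solves_integral_eq L b x0 T u x" and y: "solves_integral_eq L b x0 T u y" and t: "t \<in> {0..T}"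
  shows "x t = y t"
proof -
  have "solves_integral_eq L b 0 T (\<lambda>t. 0) (\<lambda>t. x t - y t)"
    using solves_integral_eq_combination[OF L u u x y, of 1 "-1"] by simp
  then have "x t - y t = 0"
    by (intro linear_integral_eq_unique[OF L _ _ t, of "\<lambda>t. x t - y t"]) (auto simp: solves_integral_eq_def)
  then show ?thesis by simp
qed

lemma solves_integral_eq_series:
  fixes L :: "'v::euclidean_space \<Rightarrow> 'v"
  assumes L: "linear L" and u: "u absolutely_integrable_on {0..T}"
    and x: "solves_integral_eq L b x0 T u x" and t: "t \<in> {0..T}"
  shows "x t = series_solution L b x0 u t"
proof (rule solves_integral_eq_unique[OF L _ x _ t])
  show "u integrable_on {0..T}" using u by (auto simp: absolutely_integrable_on_def)
  show "solves_integral_eq L b x0 T u (series_solution L b x0 u)"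
    using series_solution_solves[OF L u] by (simp add: solves_integral_eq_def)
qed

section \<open>Trajectories and costates\<close>

lemma AE_lebesgue_on_negligible:
  assumes "AE t in lebesgue_on S. Q t" "S \<in> sets lebesgue"
  obtains N where "negligible N" "\<And>t. t \<in> S - N \<Longrightarrow> Q t"
proof -
  have "AE t in lebesgue. t \<in> S \<longrightarrow> Q t"
    using assms by (subst (asm) AE_restrict_space_iff) auto
  then obtain N where "N \<in> null_sets lebesgue" "{t. \<not> (t \<in> S \<longrightarrow> Q t)} \<subseteq> N"
    by (auto simp: eventually_ae_filter)
  then show thesis using that[of N] by (auto simp: negligible_iff_null_sets)
qed

lemma Linf_integrable:
  assumes "u \<in> Linf T"
  shows "integrable (lebesgue_on {0..T}) u" and "u absolutely_integrable_on {0..T}" and "u integrable_on {0..T}"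
proof -
  interpret finite_measure "lebesgue_on {0..T}"
    by (rule finite_measure_lebesgue_on) auto
  from assms obtain K where "u \<in> borel_measurable (lebesgue_on {0..T})"
    "AE t in lebesgue_on {0..T}. norm (u t) \<le> K"
    by (auto simp: Linf_def)
  then show 1: "integrable (lebesgue_on {0..T}) u" by (intro integrable_const_bound)
  then show 2: "u absolutely_integrable_on {0..T}"
    by (simp add: set_integrable_def integrable_restrict_space)
  then show "u integrable_on {0..T}" by (auto simp: absolutely_integrable_on_def)
qed

text \<open>
The derivative in the sense of \<open>W\<^sup>1\<^sup>,\<^sup>1\<close> is only determined almost everywhere, whereas the integral
equation holds for every \<open>t\<close>; everything about trajectories is proved from the latter.
\<close>

lemma is_solution_iff_integral_eq:
  assumes T: "T \<ge> 0" and u: "u absolutely_integrable_on {0..T}"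
  shows "is_solution A b xbar T u \<alpha> x \<longleftrightarrow> solves_integral_eq ((*v) (A \<alpha>)) (b \<alpha>) xbar T u x"
proof
  let ?L = "(*v) (A \<alpha>)"
  assume "is_solution A b xbar T u \<alpha> x"
  then obtain y where y: "y absolutely_integrable_on {0..T}"
    and xy: "\<And>t. t \<in> {0..T} \<Longrightarrow> x t = xbar + integral {0..t} y"
    and ae: "AE t in lebesgue_on {0..T}. y t = A \<alpha> *v x t + u t *\<^sub>R b \<alpha>"
    unfolding is_solution_def has_W11_deriv_def by blast
  have yi: "y integrable_on {0..T}" using y by (auto simp: absolutely_integrable_on_def)
  have "continuous_on {0..T} (\<lambda>t. xbar + integral {0..t} y)"
    by (intro continuous_intros indefinite_integral_continuous_1 yi)
  then have "continuous_on {0..T} x"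
    using xy by (subst continuous_on_cong[OF refl]) auto
  moreover obtain N where N: "negligible N" "\<And>t. t \<in> {0..T} - N \<Longrightarrow> y t = A \<alpha> *v x t + u t *\<^sub>R b \<alpha>"
    using AE_lebesgue_on_negligible[OF ae] by auto
  have "integral {0..t} y = integral {0..t} (\<lambda>s. A \<alpha> *v x s + u s *\<^sub>R b \<alpha>)" if "t \<in> {0..T}" for t
    by (rule integral_spike[OF N(1), symmetric]) (use N(2) that in auto)
  ultimately show "solves_integral_eq ?L (b \<alpha>) xbar T u x"
    using xy by (simp add: solves_integral_eq_def)
next
  let ?L = "(*v) (A \<alpha>)"
  assume x: "solves_integral_eq ?L (b \<alpha>) xbar T u x"
  then have c: "continuous_on {0..T} x"
    and eq: "\<And>t. t \<in> {0..T} \<Longrightarrow> x t = xbar + integral {0..t} (\<lambda>s. A \<alpha> *v x s + u s *\<^sub>R b \<alpha>)"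
    by (auto simp: solves_integral_eq_def)
  have "(\<lambda>s. A \<alpha> *v x s) absolutely_integrable_on {0..T}"
    using absolutely_integrable_continuous[of 0 T "\<lambda>s. A \<alpha> *v x s"] linear_continuous_on_compose[OF c, of ?L]
    by simp
  moreover have "(\<lambda>s. u s *\<^sub>R b \<alpha>) absolutely_integrable_on {0..T}"
    using absolutely_integrable_linear[OF u, of "\<lambda>r. r *\<^sub>R b \<alpha>"] by (simp add: o_def bounded_linear_scaleR_left)
  ultimately have "(\<lambda>s. A \<alpha> *v x s + u s *\<^sub>R b \<alpha>) absolutely_integrable_on {0..T}"
    by (rule set_integral_add)
  moreover have "x 0 = xbar" using eq[of 0] T by simp
  ultimately show "is_solution A b xbar T u \<alpha> x"
    unfolding is_solution_def has_W11_deriv_def using eq by (auto intro!: exI[of _ "\<lambda>s. A \<alpha> *v x s + u s *\<^sub>R b \<alpha>"])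
qed

text \<open>
Existence of a solution is what gives meaning to the choice in the definition of
\<^const>\<open>trajectory\<close>.
\<close>

lemma trajectory_solves:
  assumes T: "T \<ge> 0" and u: "u \<in> Linf T"
  shows "solves_integral_eq ((*v) (A \<alpha>)) (b \<alpha>) xbar T u (trajectory A b xbar T u \<alpha>)"
proof -
  note iff = is_solution_iff_integral_eq[OF T Linf_integrable(2)[OF u]]
  have "solves_integral_eq ((*v) (A \<alpha>)) (b \<alpha>) xbar T u (series_solution ((*v) (A \<alpha>)) (b \<alpha>) xbar u)"
    using series_solution_solves[of "(*v) (A \<alpha>)", OF _ Linf_integrable(2)[OF u]]
    by (simp add: solves_integral_eq_def)
  then have "is_solution A b xbar T u \<alpha> (series_solution ((*v) (A \<alpha>)) (b \<alpha>) xbar u)"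
    by (simp add: iff)
  then have "is_solution A b xbar T u \<alpha> (trajectory A b xbar T u \<alpha>)"
    unfolding trajectory_def by (rule someI[where P = "is_solution A b xbar T u \<alpha>"])
  then show ?thesis by (simp add: iff)
qed

lemma Linf_combination:
  assumes "u \<in> Linf T" "w \<in> Linf T"
  shows "(\<lambda>t. r * u t + s * w t) \<in> Linf T"
proof -
  from assms obtain K M where m: "u \<in> borel_measurable (lebesgue_on {0..T})" "w \<in> borel_measurable (lebesgue_on {0..T})"
    and K: "AE t in lebesgue_on {0..T}. \<bar>u t\<bar> \<le> K" and M: "AE t in lebesgue_on {0..T}. \<bar>w t\<bar> \<le> M"
    by (auto simp: Linf_def)
  have "AE t in lebesgue_on {0..T}. \<bar>r * u t + s * w t\<bar> \<le> \<bar>r\<bar> * K + \<bar>s\<bar> * M"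
    using K M
  proof eventually_elim
    case (elim t)
    have "\<bar>r * u t + s * w t\<bar> \<le> \<bar>r\<bar> * \<bar>u t\<bar> + \<bar>s\<bar> * \<bar>w t\<bar>" by (metis abs_mult abs_triangle_ineq)
    also have "\<dots> \<le> \<bar>r\<bar> * K + \<bar>s\<bar> * M" using elim by (intro add_mono mult_left_mono) auto
    finally show ?case .
  qed
  then show ?thesis using m by (auto simp: Linf_def)
qed

lemma trajectory_affine:
  assumes T: "T \<ge> 0" and u: "u \<in> Linf T" and w: "w \<in> Linf T" and rs: "r + s = 1" and t: "t \<in> {0..T}"
  shows "trajectory A b xbar T (\<lambda>t. r * u t + s * w t) \<alpha> t =
    r *\<^sub>R trajectory A b xbar T u \<alpha> t + s *\<^sub>R trajectory A b xbar T w \<alpha> t"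
proof (rule solves_integral_eq_unique[OF _ _ _ _ t])
  show "linear ((*v) (A \<alpha>))" by simp
  have c: "(\<lambda>t. r * u t + s * w t) \<in> Linf T" using u w by (rule Linf_combination)
  then show "(\<lambda>t. r * u t + s * w t) integrable_on {0..T}" by (rule Linf_integrable)
  show "solves_integral_eq ((*v) (A \<alpha>)) (b \<alpha>) xbar T (\<lambda>t. r * u t + s * w t)
    (trajectory A b xbar T (\<lambda>t. r * u t + s * w t) \<alpha>)"
    by (rule trajectory_solves[OF T c])
  have "solves_integral_eq ((*v) (A \<alpha>)) (b \<alpha>) (r *\<^sub>R xbar + s *\<^sub>R xbar) T (\<lambda>t. r * u t + s * w t)
     (\<lambda>t. r *\<^sub>R trajectory A b xbar T u \<alpha> t + s *\<^sub>R trajectory A b xbar T w \<alpha> t)"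
    by (intro solves_integral_eq_combination trajectory_solves T u w Linf_integrable) simp
  then show "solves_integral_eq ((*v) (A \<alpha>)) (b \<alpha>) xbar T (\<lambda>t. r * u t + s * w t)
     (\<lambda>t. r *\<^sub>R trajectory A b xbar T u \<alpha> t + s *\<^sub>R trajectory A b xbar T w \<alpha> t)"
    using rs by (simp add: scaleR_add_left[symmetric])
qed

text \<open>
The difference of two trajectories solves the equation with initial value \<open>0\<close> and control \<open>u - w\<close>, and
the series for it is linear in the \<open>L\<^sup>1\<close> norm of that control. This is what makes the terminal
constraint stable under \<open>L\<^sup>1\<close> limits.
\<close>

lemma trajectory_lipschitz:
  fixes A :: "'p \<Rightarrow> real^'d^'d"
  assumes T: "T \<ge> 0"
  obtains C where "\<And>u w. u \<in> Linf T \<Longrightarrow> w \<in> Linf T \<Longrightarrow>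
    norm (trajectory A b xbar T u \<alpha> T - trajectory A b xbar T w \<alpha> T)
      \<le> C * integral {0..T} (\<lambda>t. \<bar>u t - w t\<bar>)"
proof -
  let ?L = "(*v) (A \<alpha>)"
  have L: "linear ?L" by simp
  obtain K where "K > 0" and K: "\<And>x. norm (?L x) \<le> K * norm x"
    using linear_bound[OF L] by metis
  show thesis
  proof
    fix u w assume u: "u \<in> Linf T" and w: "w \<in> Linf T"
    define v where "v t = 1 * u t + (-1) * w t" for t
    have v: "v \<in> Linf T" unfolding v_def by (intro Linf_combination u w)
    have "solves_integral_eq ?L (b \<alpha>) (1 *\<^sub>R xbar + (-1) *\<^sub>R xbar) T v
       (\<lambda>t. 1 *\<^sub>R trajectory A b xbar T u \<alpha> t + (-1) *\<^sub>R trajectory A b xbar T w \<alpha> t)"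
      unfolding v_def by (intro solves_integral_eq_combination trajectory_solves T u w Linf_integrable) simp
    then have "solves_integral_eq ?L (b \<alpha>) 0 T v (\<lambda>t. trajectory A b xbar T u \<alpha> t - trajectory A b xbar T w \<alpha> t)"
      by simp
    then have e: "trajectory A b xbar T u \<alpha> T - trajectory A b xbar T w \<alpha> T = series_solution ?L (b \<alpha>) 0 v T"
      using solves_integral_eq_series[OF L Linf_integrable(2)[OF v], of "b \<alpha>" 0 _ T] T by simp
    let ?g = "\<lambda>k. (?L ^^ k) ((T ^ k / fact k) *\<^sub>R 0 + iter_integral v (Suc k) T *\<^sub>R b \<alpha>)"
    let ?m = "norm (0::real^'d) + integral {0..T} (\<lambda>s. \<bar>v s\<bar>) * norm (b \<alpha>)"
    have bd: "norm (?g k) \<le> (K * T) ^ k /\<^sub>R fact k * ?m" for k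
      by (rule series_term_bound[OF K _ Linf_integrable(2)[OF v]]) (use \<open>K > 0\<close> T in auto)
    have s: "summable (\<lambda>k. (K * T) ^ k /\<^sub>R fact k * ?m)"
      by (intro summable_mult2 summable_exp_generic)
    have "norm (series_solution ?L (b \<alpha>) 0 v T) \<le> (\<Sum>k. (K * T) ^ k /\<^sub>R fact k * ?m)"
      unfolding series_solution_def by (rule norm_suminf_le[OF bd s])
    also have "\<dots> = exp (K * T) * ?m"
      unfolding exp_def by (rule suminf_mult2[OF summable_exp_generic, symmetric])
    finally show "norm (trajectory A b xbar T u \<alpha> T - trajectory A b xbar T w \<alpha> T)
      \<le> (exp (K * T) * norm (b \<alpha>)) * integral {0..T} (\<lambda>t. \<bar>u t - w t\<bar>)"
      unfolding e by (simp add: v_def mult_ac)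
  qed
qed

lemma matrix_uniform_bound:
  fixes A :: "'p::topological_space \<Rightarrow> real^'d^'d"
  assumes "compact P" "continuous_on P A"
  obtains K where "K \<ge> 1" and "\<And>\<alpha> x. \<alpha> \<in> P \<Longrightarrow> norm (A \<alpha> *v x) \<le> K * norm x"
proof -
  obtain M where M: "\<And>\<alpha>. \<alpha> \<in> P \<Longrightarrow> norm (A \<alpha>) \<le> M"
    using compact_imp_bounded[OF compact_continuous_image[OF assms(2,1)]] unfolding bounded_iff by blast
  show thesis
  proof
    show "max 1 (real CARD('d) * M) \<ge> 1" by simp
    fix \<alpha> x assume "\<alpha> \<in> P"
    have "norm (A \<alpha> *v x) \<le> (real CARD('d) * norm (A \<alpha>)) * norm x" by (rule norm_matrix_vector_le)
    also have "\<dots> \<le> max 1 (real CARD('d) * M) * norm x"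
      using M[OF \<open>\<alpha> \<in> P\<close>] by (intro mult_right_mono) (auto simp: le_max_iff_disj)
    finally show "norm (A \<alpha> *v x) \<le> max 1 (real CARD('d) * M) * norm x" .
  qed
qed

lemma continuous_matrix_vector_mult:
  fixes A :: "'p::topological_space \<Rightarrow> real^'d^'d"
  assumes "continuous_on P A" "continuous_on P c"
  shows "continuous_on P (\<lambda>\<alpha>. A \<alpha> *v c \<alpha>)"
  unfolding matrix_vector_mult_def by (intro continuous_intros assms)

lemma continuous_matrix_power:
  fixes A :: "'p::topological_space \<Rightarrow> real^'d^'d"
  assumes "continuous_on P A" "continuous_on P c"
  shows "continuous_on P (\<lambda>\<alpha>. ((*v) (A \<alpha>) ^^ k) (c \<alpha>))"
proof (induction k)
  case 0
  then show ?case using assms by simp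
next
  case (Suc k)
  have "continuous_on P (\<lambda>\<alpha>. A \<alpha> *v ((*v) (A \<alpha>) ^^ k) (c \<alpha>))"
    by (intro continuous_matrix_vector_mult Suc assms)
  then show ?case by simp
qed

text \<open>
The series for the end point converges uniformly on the compact parameter set. Continuity yields the
measurability in \<open>\<alpha>\<close> of the terminal gradients and of the active set.
\<close>

lemma trajectory_end_continuous:
  fixes A :: "'p::topological_space \<Rightarrow> real^'d^'d"
  assumes T: "T \<ge> 0" and P: "compact P" and A: "continuous_on P A" and b: "continuous_on P b" and u: "u \<in> Linf T"
  shows "continuous_on P (\<lambda>\<alpha>. trajectory A b xbar T u \<alpha> T)"
proof -
  obtain K where K: "K \<ge> 1" "\<And>\<alpha> x. \<alpha> \<in> P \<Longrightarrow> norm (A \<alpha> *v x) \<le> K * norm x"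
    using matrix_uniform_bound[OF P A] by blast
  obtain B where B: "\<And>\<alpha>. \<alpha> \<in> P \<Longrightarrow> norm (b \<alpha>) \<le> B"
    using compact_imp_bounded[OF compact_continuous_image[OF b P]] unfolding bounded_iff by blast
  let ?M = "integral {0..T} (\<lambda>s. \<bar>u s\<bar>)"
  have M: "?M \<ge> 0" by (rule integral_nonneg) (use Linf_integrable(2)[OF u] in \<open>auto simp: absolutely_integrable_on_def\<close>)
  define g where "g k \<alpha> = ((*v) (A \<alpha>) ^^ k) ((T ^ k / fact k) *\<^sub>R xbar + iter_integral u (Suc k) T *\<^sub>R b \<alpha>)" for k \<alpha>
  have gb: "norm (g k \<alpha>) \<le> (K * T) ^ k /\<^sub>R fact k * (norm xbar + ?M * B)" if "\<alpha> \<in> P" for k \<alpha>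
  proof -
    have "norm (g k \<alpha>) \<le> (K * T) ^ k /\<^sub>R fact k * (norm xbar + ?M * norm (b \<alpha>))"
      unfolding g_def by (rule series_term_bound[OF K(2)[OF that] _ Linf_integrable(2)[OF u]]) (use K T in auto)
    also have "\<dots> \<le> (K * T) ^ k /\<^sub>R fact k * (norm xbar + ?M * B)"
      using B[OF that] M K T by (intro mult_left_mono add_left_mono) auto
    finally show ?thesis .
  qed
  have "uniform_limit P (\<lambda>n \<alpha>. \<Sum>k<n. g k \<alpha>) (\<lambda>\<alpha>. \<Sum>k. g k \<alpha>) sequentially"
  proof (rule Weierstrass_m_test)
    show "summable (\<lambda>k. (K * T) ^ k /\<^sub>R fact k * (norm xbar + ?M * B))"
      by (intro summable_mult2 summable_exp_generic)
  qed (rule gb)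
  moreover have "continuous_on P (\<lambda>\<alpha>. \<Sum>k<n. g k \<alpha>)" for n
    unfolding g_def by (intro continuous_intros continuous_matrix_power A b)
  ultimately have c: "continuous_on P (\<lambda>\<alpha>. \<Sum>k. g k \<alpha>)"
    by (intro uniform_limit_theorem) auto
  have "trajectory A b xbar T u \<alpha> T = (\<Sum>k. g k \<alpha>)" for \<alpha>
    unfolding g_def series_solution_def[symmetric]
    by (rule solves_integral_eq_series[OF _ Linf_integrable(2)[OF u] trajectory_solves[OF T u]])
      (use T in auto)
  with c show ?thesis by simp
qed

text \<open>
Reversing time turns the costate equation into a homogeneous linear equation for
\<open>s \<mapsto> p (T - s)\<close>, whose series solution can be transposed onto \<open>c\<close>. With \<open>c = b(\<alpha>)\<close> the Taylor
coefficients of the switching function are the quantities of the controllability condition.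
\<close>

lemma costate_series:
  fixes M :: "real^'d^'d"
  assumes T: "T \<ge> 0" and q: "has_W11_deriv T p q" "AE t in lebesgue_on {0..T}. - q t = transpose M *v p t"
    and s: "s \<in> {0..T}"
  shows "p (T - s) \<bullet> c = (\<Sum>k. s ^ k / fact k * (p T \<bullet> ((*v) M ^^ k) c))"
proof -
  let ?L = "(*v) (transpose M)"
  have L: "linear ?L" by simp
  have qi: "q integrable_on {0..T}" and pq: "\<And>t. t \<in> {0..T} \<Longrightarrow> p t = p 0 + integral {0..t} q"
    using q(1) unfolding has_W11_deriv_def absolutely_integrable_on_def by blast+
  obtain N where N: "negligible N" "\<And>t. t \<in> {0..T} - N \<Longrightarrow> - q t = transpose M *v p t"
    using AE_lebesgue_on_negligible[OF q(2)] by auto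
  have qN: "q t = - (transpose M *v p t)" if "t \<in> {0..T} - N" for t
    using N(2)[OF that] by (metis minus_minus)
  have "continuous_on {0..T} (\<lambda>t. p 0 + integral {0..t} q)"
    by (intro continuous_intros indefinite_integral_continuous_1 qi)
  then have cp: "continuous_on {0..T} p"
    by (rule continuous_on_eq) (rule pq[symmetric])
  have rev: "continuous_on {0..T} (\<lambda>s. p (T - s))"
    by (rule continuous_on_compose2[OF cp]) (auto intro!: continuous_intros)
  have sol: "solves_integral_eq ?L 0 (p T) T (\<lambda>t. 0) (\<lambda>s. p (T - s))"
    unfolding solves_integral_eq_def
  proof (intro conjI ballI rev)
    fix t assume t: "t \<in> {0..T}"
    have "integral {0..T - t} q + integral {T - t..T} q = integral {0..T} q"
      by (rule Henstock_Kurzweil_Integration.integral_combine) (use t qi in auto)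
    then have 1: "p (T - t) = p T - integral {T - t..T} q"
      using pq[of "T - t"] pq[of T] t by (simp add: algebra_simps)
    have "integral {T - t..T} q = integral {T - t..T} (\<lambda>r. - (?L (p r)))"
      by (rule integral_spike[OF N(1), symmetric]) (use qN t in auto)
    also have "\<dots> = - integral {T - t..T} (\<lambda>r. ?L (p r))" by simp
    also have "integral {T - t..T} (\<lambda>r. ?L (p r)) = integral {0..t} (\<lambda>s. ?L (p (T - s)))"
    proof -
      have "((\<lambda>r. ?L (p r)) has_integral integral {T - t..T} (\<lambda>r. ?L (p r))) (cbox (T - t) T)"
        using t linear_continuous_on_compose[OF continuous_on_subset[OF cp] L, of "{T - t..T}"]
        by (auto intro!: integrable_integral integrable_continuous_interval)
      from has_integral_affinity[OF this, of "-1" T]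
      show ?thesis using t by (simp add: integral_unique)
    qed
    finally show "p (T - t) = p T + integral {0..t} (\<lambda>s. ?L (p (T - s)) + 0 *\<^sub>R 0)"
      using 1 by simp
  qed
  have "p (T - s) = series_solution ?L 0 (p T) (\<lambda>t. 0) s"
    by (rule solves_integral_eq_series[OF L _ sol s]) simp
  also have "\<dots> = (\<Sum>k. (?L ^^ k) ((s ^ k / fact k) *\<^sub>R p T))"
    by (simp add: series_solution_def)
  finally have ps: "p (T - s) = (\<Sum>k. (?L ^^ k) ((s ^ k / fact k) *\<^sub>R p T))" .
  obtain K where K: "K > 0" "\<And>x. norm (?L x) \<le> K * norm x"
    using linear_bound[OF L] by metis
  have "norm ((?L ^^ k) ((s ^ k / fact k) *\<^sub>R p T)) \<le> (K * s) ^ k /\<^sub>R fact k * norm (p T)" for k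
  proof -
    have "norm ((?L ^^ k) ((s ^ k / fact k) *\<^sub>R p T)) \<le> K ^ k * norm ((s ^ k / fact k) *\<^sub>R p T)"
      by (rule norm_funpow_le) (use K in auto)
    then show ?thesis using s by (simp add: power_mult_distrib divide_inverse mult_ac)
  qed
  then have summ: "summable (\<lambda>k. (?L ^^ k) ((s ^ k / fact k) *\<^sub>R p T))"
    by (intro summable_comparison_test'[OF summable_mult2[OF summable_exp_generic]]) auto
  have adj: "(?L ^^ k) v \<bullet> c = v \<bullet> ((*v) M ^^ k) c" for k v
  proof (induction k arbitrary: v)
    case (Suc k)
    have "(?L ^^ Suc k) v \<bullet> c = (?L ^^ k) (?L v) \<bullet> c" by (simp add: funpow_swap1)
    also have "\<dots> = ?L v \<bullet> ((*v) M ^^ k) c" by (rule Suc)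
    also have "\<dots> = v \<bullet> (M *v ((*v) M ^^ k) c)" by (metis dot_lmul_matrix inner_commute matrix_transpose_mul transpose_matrix_vector transpose_transpose)
    finally show ?case by (simp only: funpow.simps o_apply)
  qed simp
  have "(\<Sum>k. (?L ^^ k) ((s ^ k / fact k) *\<^sub>R p T)) \<bullet> c = (\<Sum>k. (?L ^^ k) ((s ^ k / fact k) *\<^sub>R p T) \<bullet> c)"
    by (rule bounded_linear.suminf[OF bounded_linear_inner_left summ])
  then show ?thesis unfolding ps adj by simp
qed

section \<open>Minimisers of the integral norm in convex closed sets\<close>

text \<open>
A direct method without weak compactness. A minimising sequence for the \<open>L\<^sup>1\<close> norm need not converge
strongly, but its members can be chosen of nearly least \<open>L\<^sup>2\<close> norm in shrinking sublevel sets. These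
sets are midpoint convex, so the parallelogram law makes such a sequence Cauchy in \<open>L\<^sup>2\<close>, hence in
\<open>L\<^sup>1\<close>; a subsequence converges almost everywhere, boundedly, to a minimiser.
\<close>

lemma (in finite_measure) L1_minimizer_exists:
  fixes U :: "('a \<Rightarrow> real) set"
  assumes ne: "U \<noteq> {}"
    and meas: "\<And>u. u \<in> U \<Longrightarrow> u \<in> borel_measurable M"
    and bdd: "\<And>u. u \<in> U \<Longrightarrow> AE x in M. \<bar>u x\<bar> \<le> 1"
    and mid: "\<And>u w. u \<in> U \<Longrightarrow> w \<in> U \<Longrightarrow> (\<lambda>x. 1/2 * u x + 1/2 * w x) \<in> U"
    and closed: "\<And>s w. (\<And>n. s n \<in> U) \<Longrightarrow> w \<in> borel_measurable M \<Longrightarrow> AE x in M. (\<lambda>n. s n x) \<longlonglongrightarrow> w x \<Longrightarrow>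
        (\<lambda>n. LINT x|M. \<bar>s n x - w x\<bar>) \<longlonglongrightarrow> 0 \<Longrightarrow> w \<in> U"
  shows "\<exists>u\<in>U. \<forall>w\<in>U. (LINT x|M. \<bar>u x\<bar>) \<le> (LINT x|M. \<bar>w x\<bar>)"
proof -
  define J where "J u = (LINT x|M. \<bar>u x\<bar>)" for u :: "'a \<Rightarrow> real"
  define Q where "Q u = (LINT x|M. (u x)\<^sup>2)" for u :: "'a \<Rightarrow> real"
  define \<mu> where "\<mu> = measure M (space M)"
  have int: "integrable M u" "integrable M (\<lambda>x. \<bar>u x\<bar>)" "integrable M (\<lambda>x. (u x)\<^sup>2)" if "u \<in> U" for u
  proof -
    show 1: "integrable M u" by (rule integrable_const_bound[of _ 1]) (use meas bdd that in auto)
    then show "integrable M (\<lambda>x. \<bar>u x\<bar>)" by simp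
    show "integrable M (\<lambda>x. (u x)\<^sup>2)"
    proof (rule integrable_const_bound[of _ 1])
      show "AE x in M. norm ((u x)\<^sup>2) \<le> 1"
        using bdd[OF that] by eventually_elim (simp add: abs_square_le_1)
    qed (use meas that in simp)
  qed
  have intp: "integrable M (\<lambda>x. u x * w x)" if "u \<in> U" "w \<in> U" for u w
  proof (rule integrable_const_bound[of _ 1])
    show "AE x in M. norm (u x * w x) \<le> 1"
      using bdd[OF that(1)] bdd[OF that(2)] by eventually_elim (auto simp: abs_mult intro!: mult_le_one)
  qed (use meas that in simp)
  have Q_le: "Q u \<le> \<mu>" if "u \<in> U" for u
  proof -
    have "Q u \<le> (LINT x|M. 1)"
      unfolding Q_def using bdd[OF that] int[OF that]
      by (intro integral_mono_AE) (auto simp: abs_square_le_1)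
    then show ?thesis by (simp add: \<mu>_def)
  qed
  have J0: "J u \<ge> 0" for u by (simp add: J_def)
  define m where "m = Inf (J ` U)"
  have m_le: "m \<le> J u" if "u \<in> U" for u
    unfolding m_def using J0 that by (intro cINF_lower) (auto intro!: bdd_belowI2)
  define K where "K n = {u \<in> U. J u \<le> m + 1 / real (Suc n)}" for n
  have K_ne: "K n \<noteq> {}" for n
  proof -
    have "\<exists>j\<in>J ` U. j < m + 1 / real (Suc n)"
      unfolding m_def using ne by (intro cInf_lessD) auto
    then show ?thesis by (auto simp: K_def intro: less_imp_le)
  qed
  have K_mono: "K n \<subseteq> K k" if "k \<le> n" for k n
  proof -
    have "1 / real (Suc n) \<le> 1 / real (Suc k)" using that by (intro divide_left_mono) auto
    then show ?thesis by (auto simp: K_def)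
  qed
  have K_mid: "(\<lambda>x. 1/2 * u x + 1/2 * w x) \<in> K n" if "u \<in> K n" "w \<in> K n" for u w n
  proof -
    from that have uw: "u \<in> U" "w \<in> U" by (auto simp: K_def)
    have "J (\<lambda>x. 1/2 * u x + 1/2 * w x) \<le> (LINT x|M. 1/2 * \<bar>u x\<bar> + 1/2 * \<bar>w x\<bar>)"
      unfolding J_def using int uw int[OF mid[OF uw]] by (intro integral_mono) auto
    also have "\<dots> = 1/2 * J u + 1/2 * J w"
      unfolding J_def using int uw by simp
    also have "\<dots> \<le> m + 1 / real (Suc n)" using that by (auto simp: K_def)
    finally show ?thesis using mid[OF uw] by (simp add: K_def)
  qed
  define d where "d n = Inf (Q ` K n)" for n
  have Q0: "Q u \<ge> 0" for u by (simp add: Q_def)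
  have d_le: "d n \<le> Q u" if "u \<in> K n" for u n
    unfolding d_def using Q0 that by (intro cINF_lower) (auto intro!: bdd_belowI2)
  have d_bdd: "bdd_above (range d)"
  proof (rule bdd_aboveI2)
    fix n
    obtain u where "u \<in> K n" using K_ne by blast
    then show "d n \<le> \<mu>" using d_le[of u n] Q_le[of u] by (auto simp: K_def)
  qed
  \<comment> \<open>The least squared norms increase along the shrinking sublevel sets; \<open>D\<close> is their limit.\<close>
  define D where "D = (SUP n. d n)"
  have d_D: "d n \<le> D" for n unfolding D_def by (rule cSUP_upper) (use d_bdd in auto)
  have d_mono: "d k \<le> d n" if "k \<le> n" for k n
    unfolding d_def using K_mono[OF that] K_ne Q0 by (intro cINF_superset_mono) (auto intro!: bdd_belowI2)
  have "\<exists>N u. n \<le> N \<and> D - 1 / real (Suc n) < d N \<and> u \<in> K N \<and> Q u < D + 1 / real (Suc n)" for n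
  proof -
    have "\<exists>N. D - 1 / real (Suc n) < d N"
      using less_cSUP_iff[OF _ d_bdd, of "D - 1 / real (Suc n)"] by (simp add: D_def)
    then obtain N where N: "D - 1 / real (Suc n) < d N" by blast
    have 1: "D - 1 / real (Suc n) < d (max n N)" using N d_mono[of N "max n N"] by simp
    have "\<exists>q\<in>Q ` K (max n N). q < D + 1 / real (Suc n)"
    proof (rule cInf_lessD)
      have "0 < 1 / real (Suc n)" by simp
      then show "Inf (Q ` K (max n N)) < D + 1 / real (Suc n)"
        using d_D[of "max n N"] unfolding d_def by linarith
    qed (use K_ne in auto)
    with 1 show ?thesis by (intro exI[of _ "max n N"]) auto
  qed
  then obtain N s where N: "\<And>n. n \<le> N n" "\<And>n. D - 1 / real (Suc n) < d (N n)"
    and s: "\<And>n. s n \<in> K (N n)" "\<And>n. Q (s n) < D + 1 / real (Suc n)" by metis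
  have sU: "s n \<in> U" for n using s(1)[of n] by (simp add: K_def)
  \<comment> \<open>The midpoint lies in the larger of the two sublevel sets, so its squared norm is at least almost \<open>D\<close>.\<close>
  have quad: "(LINT x|M. (s i x - s j x)\<^sup>2) \<le> 6 * (1 / real (Suc i) + 1 / real (Suc j))" for i j
  proof -
    let ?k = "min (N i) (N j)"
    let ?h = "\<lambda>x. 1/2 * s i x + 1/2 * s j x"
    have "s i \<in> K ?k" "s j \<in> K ?k" using s(1) K_mono[of ?k "N i"] K_mono[of ?k "N j"] by auto
    then have "d ?k \<le> Q ?h" by (intro d_le K_mid)
    moreover have "D - (1 / real (Suc i) + 1 / real (Suc j)) \<le> d ?k"
    proof -
      have "0 < 1 / real (Suc i)" "0 < 1 / real (Suc j)" by simp_all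
      moreover have "d ?k = d (N i) \<or> d ?k = d (N j)" by (auto simp: min_def)
      ultimately show ?thesis using N(2)[of i] N(2)[of j] by linarith
    qed
    moreover have "(LINT x|M. (s i x - s j x)\<^sup>2) = 2 * Q (s i) + 2 * Q (s j) - 4 * Q ?h"
    proof -
      have "(LINT x|M. (s i x - s j x)\<^sup>2) = (LINT x|M. 2 * (s i x)\<^sup>2 + 2 * (s j x)\<^sup>2 - 4 * (?h x)\<^sup>2)"
        by (rule arg_cong[where f = "integral\<^sup>L M"]) (auto simp: fun_eq_iff power2_eq_square field_simps)
      also have "\<dots> = 2 * Q (s i) + 2 * Q (s j) - 4 * Q ?h"
        unfolding Q_def using int(3)[OF sU] int(3)[OF mid[OF sU sU]] by simp
      finally show ?thesis .
    qed
    ultimately show ?thesis using s(2)[of i] s(2)[of j] by (simp add: distrib_left)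
  qed
  have cauchy: "\<exists>n0. \<forall>i\<ge>n0. \<forall>j\<ge>n0. (LINT x|M. norm (s i x - s j x)) < e" if e: "e > 0" for e
  proof -
    define a where "a = e / (\<mu> + 1)"
    have \<mu>0: "\<mu> \<ge> 0" by (simp add: \<mu>_def)
    have a: "a > 0" "a * \<mu> < e" using e \<mu>0 by (auto simp: a_def field_simps)
    obtain n0 where n0: "12 / (a * e) < real n0" using reals_Archimedean2 by blast
    show ?thesis
    proof (intro exI[of _ n0] allI impI)
      fix i j assume ij: "i \<ge> n0" "j \<ge> n0"
      have ids: "integrable M (\<lambda>x. (s i x - s j x)\<^sup>2)"
        using int(3)[OF sU] intp[OF sU sU] by (simp add: power2_diff mult.assoc)
      have idn: "integrable M (\<lambda>x. norm (s i x - s j x))"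
        using int(1)[OF sU] by simp
      \<comment> \<open>Arithmetic-geometric mean inequality with a weight \<open>a\<close>, passing from \<open>L\<^sup>2\<close> to \<open>L\<^sup>1\<close>.\<close>
      have pw: "norm (s i x - s j x) \<le> a / 2 + (s i x - s j x)\<^sup>2 / (2 * a)" for x
      proof -
        have "2 * a * \<bar>z\<bar> \<le> a\<^sup>2 + z\<^sup>2" for z
          using zero_le_power2[of "\<bar>z\<bar> - a"] by (simp add: power2_diff mult_ac)
        from this[of "s i x - s j x"] show ?thesis using a by (simp add: field_simps power2_eq_square)
      qed
      have "(LINT x|M. norm (s i x - s j x)) \<le> (LINT x|M. a / 2 + (s i x - s j x)\<^sup>2 / (2 * a))"
        by (intro integral_mono idn pw) (use ids in auto)
      also have "\<dots> = a / 2 * \<mu> + (LINT x|M. (s i x - s j x)\<^sup>2) / (2 * a)"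
        using ids by (simp add: \<mu>_def)
      also have "\<dots> \<le> a / 2 * \<mu> + 6 * (1 / real (Suc i) + 1 / real (Suc j)) / (2 * a)"
        using quad a by (intro add_left_mono divide_right_mono) auto
      also have "\<dots> \<le> a / 2 * \<mu> + 6 * (1 / real (Suc n0) + 1 / real (Suc n0)) / (2 * a)"
        using ij a by (intro add_left_mono divide_right_mono mult_left_mono add_mono divide_left_mono) auto
      also have "\<dots> < e"
      proof -
        have "12 < real (Suc n0) * (a * e)" using n0 a e by (simp add: field_simps) (smt (verit) mult_pos_pos)
        moreover have "0 < real (Suc n0) * (2 * a)" using a by simp
        moreover have "e / 2 * (real (Suc n0) * (2 * a)) = real (Suc n0) * (a * e)" by simp
        ultimately have "12 / (real (Suc n0) * (2 * a)) < e / 2" by (simp only: pos_divide_less_eq)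
        moreover have "6 * (1 / real (Suc n0) + 1 / real (Suc n0)) / (2 * a) = 12 / (real (Suc n0) * (2 * a))"
          by simp
        ultimately show ?thesis using a by linarith
      qed
      finally show "(LINT x|M. norm (s i x - s j x)) < e" .
    qed
  qed
  obtain r where r: "strict_mono r" "AE x in M. Cauchy (\<lambda>i. s (r i) x)"
    using cauchy_L1_AE_cauchy_subseq[of M s] int(1)[OF sU] cauchy by blast
  define w where "w x = lim (\<lambda>i. s (r i) x)" for x
  have wm: "w \<in> borel_measurable M"
    unfolding w_def by (rule borel_measurable_lim_metric) (rule meas[OF sU])
  have conv: "AE x in M. (\<lambda>i. s (r i) x) \<longlonglongrightarrow> w x"
    using r(2) by eventually_elim (simp add: w_def Cauchy_convergent_iff convergent_LIMSEQ_iff)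
  have bnd: "AE x in M. \<forall>i. \<bar>s (r i) x\<bar> \<le> 1"
    unfolding AE_all_countable using bdd[OF sU] by blast
  have lim0: "(\<lambda>i. LINT x|M. \<bar>s (r i) x - w x\<bar>) \<longlonglongrightarrow> (LINT x|M. 0)"
  proof (rule integral_dominated_convergence[of _ _ _ "\<lambda>_. 2"])
    show "(\<lambda>x. \<bar>s (r i) x - w x\<bar>) \<in> borel_measurable M" for i
      using wm meas[OF sU] by simp
    show "AE x in M. (\<lambda>i. \<bar>s (r i) x - w x\<bar>) \<longlonglongrightarrow> 0"
      using conv by eventually_elim (simp add: tendsto_rabs_zero_iff LIM_zero)
    show "AE x in M. norm \<bar>s (r i) x - w x\<bar> \<le> 2" for i
      using conv bnd
    proof eventually_elim
      case (elim x)
      have "\<bar>w x\<bar> \<le> 1"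
        by (rule LIMSEQ_le_const2[OF tendsto_rabs[OF elim(1)]]) (use elim(2) in auto)
      moreover have "\<bar>s (r i) x\<bar> \<le> 1" using elim(2) by blast
      ultimately show ?case by simp
    qed
  qed auto
  then have lim: "(\<lambda>i. LINT x|M. \<bar>s (r i) x - w x\<bar>) \<longlonglongrightarrow> 0" by simp
  have wU: "w \<in> U"
    by (rule closed[of "\<lambda>i. s (r i)", OF sU wm conv lim])
  have "J w \<le> m"
  proof (rule LIMSEQ_le_const)
    show "(\<lambda>i. m + 1 / real (Suc i) + (LINT x|M. \<bar>s (r i) x - w x\<bar>)) \<longlonglongrightarrow> m"
      using tendsto_add[OF tendsto_add[OF tendsto_const[of m] LIMSEQ_Suc[OF lim_1_over_n]] lim] by simp
    have "J w \<le> m + 1 / real (Suc i) + (LINT x|M. \<bar>s (r i) x - w x\<bar>)" for i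
    proof -
      have "J w \<le> (LINT x|M. \<bar>s (r i) x\<bar> + \<bar>s (r i) x - w x\<bar>)"
        unfolding J_def using int[OF wU] int[OF sU] by (intro integral_mono) auto
      also have "\<dots> = J (s (r i)) + (LINT x|M. \<bar>s (r i) x - w x\<bar>)"
        unfolding J_def using int[OF wU] int[OF sU] by simp
      finally have "J w \<le> J (s (r i)) + (LINT x|M. \<bar>s (r i) x - w x\<bar>)" .
      moreover have "i \<le> N (r i)" using seq_suble[OF r(1), of i] N(1)[of "r i"] by simp
      then have "s (r i) \<in> K i" using s(1)[of "r i"] K_mono by blast
      then have "J (s (r i)) \<le> m + 1 / real (Suc i)" by (simp add: K_def)
      ultimately show ?thesis by simp
    qed
    then show "\<exists>n0. \<forall>i\<ge>n0. J w \<le> m + 1 / real (Suc i) + (LINT x|M. \<bar>s (r i) x - w x\<bar>)" by blast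
  qed
  then show ?thesis
    using wU m_le unfolding J_def by (meson order_trans)
qed

section \<open>Gradients, supports and the two cost functionals\<close>

text \<open>
The Riesz representative of the derivative is the unique gradient, which resolves the definite
description in the definition of \<^const>\<open>gradient\<close>.
\<close>

lemma GDERIV_gradient:
  fixes f :: "'a::euclidean_space \<Rightarrow> real"
  assumes "(f has_derivative f') (at x)"
  shows "GDERIV f x :> gradient f x" and "gradient f x = (\<Sum>i\<in>Basis. f' i *\<^sub>R i)"
proof -
  define g where "g = (\<Sum>i\<in>Basis. f' i *\<^sub>R i)"
  have lin: "linear f'" using assms has_derivative_linear by blast
  have "f' h = h \<bullet> g" for h
  proof -
    have "f' h = f' (\<Sum>i\<in>Basis. (h \<bullet> i) *\<^sub>R i)" by (simp add: euclidean_representation)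
    also have "\<dots> = h \<bullet> g" using lin by (simp add: g_def linear_sum linear_scale inner_sum_right mult.commute)
    finally show ?thesis .
  qed
  then have f'_eq: "f' = (\<lambda>h. h \<bullet> g)" by (rule ext)
  have g: "GDERIV f x :> g" using assms unfolding gderiv_def f'_eq .
  have "g' = g" if "GDERIV f x :> g'" for g'
  proof -
    have "(\<lambda>h. h \<bullet> g') = (\<lambda>h. h \<bullet> g)"
      using has_derivative_unique that g unfolding gderiv_def by blast
    then have "h \<bullet> g' = h \<bullet> g" for h by (rule fun_cong)
    then show ?thesis using vector_eq_ldot by blast
  qed
  then have eq: "gradient f x = g" unfolding gradient_def using g by (intro the_equality)
  then show "gradient f x = (\<Sum>i\<in>Basis. f' i *\<^sub>R i)" by (simp only: g_def)
  show "GDERIV f x :> gradient f x" unfolding eq by (rule g)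
qed

lemma C1_on_gradient:
  fixes f :: "'a::euclidean_space \<Rightarrow> real"
  assumes "C1_on f UNIV"
  shows "GDERIV f x :> gradient f x" and "continuous_on UNIV (gradient f)"
proof -
  from assms obtain f' :: "'a \<Rightarrow> 'a \<Rightarrow>\<^sub>L real" where
    f': "\<And>x. (f has_derivative blinfun_apply (f' x)) (at x)" and c: "continuous_on UNIV f'"
    unfolding C1_on_def by blast
  show "GDERIV f x :> gradient f x" by (rule GDERIV_gradient(1)[OF f'])
  have "gradient f = (\<lambda>x. \<Sum>i\<in>Basis. f' x i *\<^sub>R i)"
    using GDERIV_gradient(2)[OF f'] by (simp add: fun_eq_iff)
  moreover have "continuous_on UNIV (\<lambda>x. \<Sum>i\<in>Basis. f' x i *\<^sub>R i)"
    by (intro continuous_intros c)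
  ultimately show "continuous_on UNIV (gradient f)" by simp
qed

lemma C1_on_continuous:
  assumes "C1_on f V" "P \<subseteq> V"
  shows "continuous_on P f"
proof (rule continuous_at_imp_continuous_on, rule ballI)
  fix x assume "x \<in> P"
  then have "x \<in> V" using assms(2) by blast
  then obtain f' where "(f has_derivative f') (at x)" using assms(1) unfolding C1_on_def by blast
  then show "isCont f x" by (rule has_derivative_continuous)
qed

text \<open>
Otherwise \<open>\<psi>\<close> would increase from \<open>0\<close> along the segment from \<open>x\<close> to a point of the sublevel set,
contrary to convexity.
\<close>

lemma gradient_in_normal_cone:
  fixes \<psi> :: "real^'d \<Rightarrow> real"
  assumes conv: "convex_on UNIV \<psi>" and g: "GDERIV \<psi> x :> g" and x: "\<psi> x = 0"
  shows "g \<in> normal_cone (terminal_set \<psi>) x"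
  unfolding normal_cone_def
proof (intro CollectI ballI)
  fix y assume "y \<in> terminal_set \<psi>"
  then have y: "\<psi> y \<le> 0" by (simp add: terminal_set_def)
  show "g \<bullet> (y - x) \<le> 0"
  proof (rule ccontr)
    assume "\<not> g \<bullet> (y - x) \<le> 0"
    then have pos: "(y - x) \<bullet> g > 0" by (simp add: inner_commute)
    have line: "((\<lambda>t. x + t *\<^sub>R (y - x)) has_derivative (\<lambda>t. t *\<^sub>R (y - x))) (at (0::real))"
      by (auto intro!: derivative_eq_intros)
    have "((\<lambda>t. \<psi> (x + t *\<^sub>R (y - x))) has_derivative (\<lambda>t. (t *\<^sub>R (y - x)) \<bullet> g)) (at 0)"
      using diff_chain_at[OF line, of \<psi> "\<lambda>h. h \<bullet> g"] g by (simp add: gderiv_def o_def)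
    then have "((\<lambda>t. \<psi> (x + t *\<^sub>R (y - x))) has_real_derivative ((y - x) \<bullet> g)) (at 0)"
      by (simp add: has_field_derivative_def mult_commute_abs)
    from DERIV_pos_inc_right[OF this pos] obtain d where "d > 0"
      and d: "\<And>h. 0 < h \<Longrightarrow> h < d \<Longrightarrow> \<psi> (x + 0 *\<^sub>R (y - x)) < \<psi> (x + (0 + h) *\<^sub>R (y - x))"
      by blast
    define h where "h = min 1 (d / 2)"
    have h: "0 < h" "h < d" "h \<le> 1" using \<open>d > 0\<close> by (auto simp: h_def)
    have "x + h *\<^sub>R (y - x) = (1 - h) *\<^sub>R x + h *\<^sub>R y" by (simp add: algebra_simps)
    then have "\<psi> (x + h *\<^sub>R (y - x)) \<le> (1 - h) * \<psi> x + h * \<psi> y"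
      using convex_onD[OF conv, of h x y] h by simp
    also have "\<dots> \<le> 0" using x y h by (simp add: mult_le_0_iff)
    finally show False using d[of h] h x by simp
  qed
qed

text \<open>
The complement of the support is a union of relatively open null sets, and a countable base reduces
it to a countable union.
\<close>

lemma AE_in_measure_supp:
  fixes P :: "'p::euclidean_space set"
  assumes "radon_measure_on P \<Lambda>"
  shows "AE \<alpha> in \<Lambda>. \<alpha> \<in> measure_supp \<Lambda>"
proof -
  have sets: "sets \<Lambda> = sets (restrict_space borel P)" using assms by (simp add: radon_measure_on_def)
  then have sp: "space \<Lambda> = P" using sets_eq_imp_space_eq[OF sets] by (simp add: space_restrict_space)
  have open_sets: "W \<inter> P \<in> sets \<Lambda>" if "open W" for W
    unfolding sets sets_restrict_space using that by auto
  obtain B :: "'p set set" where B: "countable B" "topological_basis B" using ex_countable_basis by blast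
  define B0 where "B0 = {W \<in> B. emeasure \<Lambda> (W \<inter> P) = 0}"
  have "(\<Union>W\<in>B0. W \<inter> P) \<in> null_sets \<Lambda>"
  proof (rule null_sets_UN')
    show "countable B0" using B by (auto simp: B0_def)
    fix W assume "W \<in> B0"
    then show "W \<inter> P \<in> null_sets \<Lambda>"
      using open_sets topological_basis_open[OF B(2)] by (auto simp: B0_def null_sets_def)
  qed
  then show ?thesis
  proof (rule AE_I')
    show "{\<alpha> \<in> space \<Lambda>. \<alpha> \<notin> measure_supp \<Lambda>} \<subseteq> (\<Union>W\<in>B0. W \<inter> P)"
    proof
      fix \<alpha> assume "\<alpha> \<in> {\<alpha> \<in> space \<Lambda>. \<alpha> \<notin> measure_supp \<Lambda>}"
      then obtain W where W: "\<alpha> \<in> P" "open W" "\<alpha> \<in> W" "emeasure \<Lambda> (W \<inter> P) = 0"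
        by (auto simp: measure_supp_def sp)
      then obtain W' where W': "W' \<in> B" "\<alpha> \<in> W'" "W' \<subseteq> W"
        using topological_basisE[OF B(2)] by metis
      have "emeasure \<Lambda> (W' \<inter> P) \<le> emeasure \<Lambda> (W \<inter> P)"
        using W' W open_sets[OF W(2)] by (intro emeasure_mono) auto
      then show "\<alpha> \<in> (\<Union>W\<in>B0. W \<inter> P)" using W W' by (auto simp: B0_def)
    qed
  qed
qed

text \<open>
The function \<open>v \<mapsto> a v - \<eta> \<bar>v\<bar>\<close> is piecewise linear with slopes \<open>a - \<eta>\<close> and \<open>a + \<eta>\<close>; when neither
vanishes, a maximiser on \<open>[-1, 1]\<close> is a break point or an end point.
\<close>

lemma maximiser_bang_off_bang:
  fixes a \<eta> w :: real
  assumes "is_arg_max (\<lambda>v. a * v - \<eta> * \<bar>v\<bar>) (\<lambda>v. v \<in> {-1..1}) w" and "\<eta> > 0" "a \<noteq> \<eta>" "a \<noteq> - \<eta>"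
  shows "w \<in> {-1, 0, 1}"
proof -
  have w: "-1 \<le> w" "w \<le> 1" and max: "\<And>v. -1 \<le> v \<Longrightarrow> v \<le> 1 \<Longrightarrow> a * v - \<eta> * \<bar>v\<bar> \<le> a * w - \<eta> * \<bar>w\<bar>"
    using assms(1) by (auto simp: is_arg_max_def not_less)
  consider "a > \<eta>" | "a < - \<eta>" | "- \<eta> < a" "a < \<eta>" using assms by linarith
  then show ?thesis
  proof cases
    case 1
    have "a * w - \<eta> * \<bar>w\<bar> \<le> (a - \<eta>) * w"
      using assms(2) mult_left_mono[of w "\<bar>w\<bar>" \<eta>] by (simp add: algebra_simps)
    then have "(a - \<eta>) * 1 \<le> (a - \<eta>) * w" using max[of 1] by simp
    then have "1 \<le> w" using 1 by (simp add: mult_le_cancel_left)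
    then show ?thesis using w by simp
  next
    case 2
    have "a * w - \<eta> * \<bar>w\<bar> \<le> (a + \<eta>) * w"
      using assms(2) mult_left_mono[of "-w" "\<bar>w\<bar>" \<eta>] abs_ge_minus_self[of w] by (simp add: algebra_simps)
    then have "(a + \<eta>) * (-1) \<le> (a + \<eta>) * w" using max[of "-1"] by simp
    then have "w \<le> -1" by (subst (asm) mult_le_cancel_left_neg) (use 2 in auto)
    then show ?thesis using w by simp
  next
    case 3
    have "a * w \<le> \<bar>a\<bar> * \<bar>w\<bar>" by (metis abs_ge_self abs_mult)
    moreover have "0 \<le> a * w - \<eta> * \<bar>w\<bar>" using max[of 0] by simp
    ultimately have "0 \<le> (\<bar>a\<bar> - \<eta>) * \<bar>w\<bar>" by (simp add: algebra_simps)
    moreover have "\<bar>a\<bar> - \<eta> < 0" using 3 by linarith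
    ultimately have "\<bar>w\<bar> = 0" by (metis abs_ge_zero linorder_not_less mult_neg_pos order_le_less)
    then show ?thesis by simp
  qed
qed

text \<open>
\<open>\<bar>u\<bar>\<close> is bounded by the indicator function of its own nonzero set, with equality exactly where \<open>u\<close>
takes the values \<open>-1\<close>, \<open>0\<close> and \<open>1\<close>.
\<close>

lemma J1_le_J0:
  assumes u: "u \<in> Linf T" and b: "AE t in lebesgue_on {0..T}. u t \<in> {-1..1}"
  shows "J1 T u \<le> J0 T u"
    and "(AE t in lebesgue_on {0..T}. u t \<in> {-1, 0, 1}) \<Longrightarrow> J1 T u = J0 T u"
proof -
  let ?M = "lebesgue_on {0..T}" and ?S = "{t \<in> {0..T}. u t \<noteq> 0}"
  interpret finite_measure ?M by (rule finite_measure_lebesgue_on) auto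
  have um: "u \<in> borel_measurable ?M" using u by (simp add: Linf_def)
  have "{t \<in> space ?M. u t \<noteq> 0} \<in> sets ?M" using um by measurable
  then have S: "?S \<in> sets ?M" by simp
  have J0: "J0 T u = (LINT t|?M. indicator ?S t)"
  proof -
    have "measure ?M ?S = measure lebesgue ?S" by (rule measure_restrict_space) auto
    moreover have "?S \<inter> space ?M = ?S" by auto
    ultimately show ?thesis by (simp only: J0_def Bochner_Integration.integral_indicator)
  qed
  have i1: "integrable ?M (indicator ?S :: real \<Rightarrow> real)"
    by (rule integrable_real_indicator[OF S]) (use emeasure_finite[of ?S] in \<open>simp only: infinity_ennreal_def less_top\<close>)
  have i2: "integrable ?M (\<lambda>t. \<bar>u t\<bar>)" using Linf_integrable(1)[OF u] by simp
  have sp: "AE t in ?M. t \<in> {0..T}" by (rule AE_I2) simp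
  show "J1 T u \<le> J0 T u"
    unfolding J0 J1_def
  proof (rule integral_mono_AE[OF i2 i1])
    show "AE t in ?M. \<bar>u t\<bar> \<le> indicator ?S t"
      using b sp by eventually_elim (auto simp: indicator_def)
  qed
  assume "AE t in ?M. u t \<in> {-1, 0, 1}"
  then have "AE t in ?M. \<bar>u t\<bar> = indicator ?S t"
    using sp by eventually_elim (auto simp: indicator_def)
  then show "J1 T u = J0 T u"
    unfolding J0 J1_def using i1 i2 by (intro integral_cong_AE borel_measurable_integrable)
qed

section \<open>Optimal controls take the values minus one, zero and one\<close>

text \<open>
The switching function \<open>\<phi>\<close> is, up to sign, the restriction to \<open>[0, T]\<close> of the entire function
\<open>\<Sum>n. s\<^sup>n c\<^sub>n / n!\<close> with \<open>s = T - t\<close> and \<open>c\<^sub>n = \<integral> v \<bullet> A\<^sup>n b d\<Lambda>\<close>, where \<open>v = \<mu> \<nabla>\<psi>(x(T))\<close> lies in the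
normal cones. If \<open>\<phi>\<close> takes a value \<open>a \<noteq> 0\<close> infinitely often, then \<open>c\<^sub>0 = - a\<close> and all later \<open>c\<^sub>n\<close> vanish;
controllability then gives \<open>v = 0\<close> almost everywhere and so \<open>c\<^sub>0 = 0\<close>. Hence \<open>\<bar>\<phi>\<bar> = \<eta>\<close> only at finitely
many times, and elsewhere the maximum condition leaves the values \<open>-1\<close>, \<open>0\<close> and \<open>1\<close>.

The multiplier \<open>\<mu>\<close> need not be measurable, and only \<open>p(t) \<bullet> b\<close> is known to be integrable. Both gaps are
closed by sampling \<open>p(T - s) \<bullet> b\<close> at \<open>s = 0, h, \<dots>, (d - 1) h\<close>: the samples dominate all \<open>p(T) \<bullet> A\<^sup>n b\<close>, so
these are integrable, and where all samples vanish so do all \<open>p(T) \<bullet> A\<^sup>n b\<close> and \<open>v\<close> may be replaced by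
\<open>0\<close>; elsewhere \<open>\<mu>\<close> is a quotient of measurable functions.
\<close>

lemma bang_off_bang:
  fixes A :: "'p::euclidean_space \<Rightarrow> real^'d^'d" and b :: "'p \<Rightarrow> real^'d" and x :: "'p \<Rightarrow> real \<Rightarrow> real^'d"
  assumes T: "T > 0" and P: "compact P" and A: "continuous_on P A" and b: "continuous_on P b"
    and \<psi>: "C1_on \<psi> UNIV" "convex_on UNIV \<psi>"
    and x: "continuous_on P (\<lambda>\<alpha>. x \<alpha> T)"
    and pmp: "robust_pmp A b T \<psi> P u x \<eta> \<Lambda> p \<mu>" and \<eta>: "\<eta> > 0"
    and ctrl: "avg_controllability A b \<psi> P (\<lambda>\<alpha>. x \<alpha> T) \<Lambda>"
  shows "AE t in lebesgue_on {0..T}. u t \<in> {-1, 0, 1}"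
proof -
  let ?N = "CARD('d)"
  have N0: "0 < ?N" by simp
  have radon: "radon_measure_on P \<Lambda>" using pmp by (simp add: robust_pmp_def)
  then have sets: "sets \<Lambda> = sets (restrict_space borel P)" and "finite_measure \<Lambda>"
    by (auto simp: radon_measure_on_def)
  then have sp: "space \<Lambda> = P" using sets_eq_imp_space_eq[OF sets] by (simp add: space_restrict_space)
  have cont_meas: "g \<in> borel_measurable \<Lambda>" if "continuous_on P g" for g :: "'p \<Rightarrow> 'e::topological_space"
    using borel_measurable_continuous_on_restrict[OF that] measurable_cong_sets[OF sets refl] by blast
  have AE_P: "AE \<alpha> in \<Lambda>. \<alpha> \<in> P" using AE_space[of \<Lambda>] by (simp add: sp)

  define Ab where "Ab n \<alpha> = ((*v) (A \<alpha>) ^^ n) (b \<alpha>)" for n \<alpha>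
  have Ab_cont: "continuous_on P (Ab n)" for n
    unfolding Ab_def by (rule continuous_matrix_power[OF A b])
  define dpsi where "dpsi \<alpha> = gradient \<psi> (x \<alpha> T)" for \<alpha>
  have dpsi_cont: "continuous_on P dpsi"
    unfolding dpsi_def by (rule continuous_on_compose2[OF C1_on_gradient(2)[OF \<psi>(1)] x]) auto

  obtain C where C: "C \<ge> 0" and rec: "\<And>\<alpha>. \<alpha> \<in> P \<Longrightarrow> \<exists>c. (\<forall>k<?N. \<bar>c k\<bar> \<le> C) \<and>
      (\<forall>v n. ((*v) (A \<alpha>) ^^ (n + ?N)) v = (\<Sum>k<?N. c k *\<^sub>R ((*v) (A \<alpha>) ^^ (n + k)) v))"
    using powers_bounded_recurrence[OF P A] by blast
  define K where "K = max 1 (real ?N * C)"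
  have K: "K \<ge> 1" "K \<ge> real ?N * C" by (auto simp: K_def)
  have growth: "\<bar>w \<bullet> Ab n \<alpha>\<bar> \<le> K ^ n * (\<Sum>k<?N. \<bar>w \<bullet> Ab k \<alpha>\<bar>)" if \<alpha>: "\<alpha> \<in> P" for w n \<alpha>
  proof -
    obtain c where c: "\<And>k. k < ?N \<Longrightarrow> \<bar>c k\<bar> \<le> C"
      and r: "\<And>n. Ab (n + ?N) \<alpha> = (\<Sum>k<?N. c k *\<^sub>R Ab (n + k) \<alpha>)"
      using rec[OF \<alpha>] unfolding Ab_def by blast
    show ?thesis
      by (rule recurrence_growth[of "\<lambda>n. w \<bullet> Ab n \<alpha>" ?N c C K, OF _ c K C]) (simp_all add: r inner_sum_right)
  qed
  obtain h Cs where h: "h > 0" "real ?N * h \<le> T" and Cs: "Cs \<ge> 0"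
    and samples: "\<forall>F :: nat \<Rightarrow> real. (\<forall>n. \<bar>F n\<bar> \<le> K ^ n * (\<Sum>k<?N. \<bar>F k\<bar>)) \<longrightarrow>
      (\<Sum>k<?N. \<bar>F k\<bar>) \<le> Cs * (\<Sum>j<?N. \<bar>\<Sum>n. (real j * h) ^ n / fact n * F n\<bar>)"
    using coefficients_bounded_by_samples[OF K(1) T N0] by (elim exE conjE) (rule that)
  have jh: "real j * h \<in> {0..T}" if "j < ?N" for j
  proof -
    have "real j * h \<le> real ?N * h" using that h by simp
    then have "real j * h \<le> T" using h(2) by linarith
    moreover have "0 \<le> real j * h" using h(1) by simp
    ultimately show ?thesis unfolding atLeastAtMost_iff by blast
  qed

  define F where "F \<alpha> n = p T \<alpha> \<bullet> Ab n \<alpha>" for \<alpha> n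
  define f where "f s \<alpha> = p (T - s) \<alpha> \<bullet> b \<alpha>" for s \<alpha>
  have f_int: "integrable \<Lambda> (f s)" if "s \<in> {0..T}" for s
  proof -
    have "T - s \<in> {0..T}" using that by auto
    then show ?thesis using pmp unfolding robust_pmp_def f_def by blast
  qed
  have AE_f: "AE \<alpha> in \<Lambda>. \<forall>s\<in>{0..T}. f s \<alpha> = (\<Sum>n. s ^ n / fact n * F \<alpha> n)"
  proof -
    have "AE \<alpha> in \<Lambda>. \<exists>q. has_W11_deriv T (\<lambda>t. p t \<alpha>) q \<and>
        (AE t in lebesgue_on {0..T}. - q t = transpose (A \<alpha>) *v p t \<alpha>)"
      using pmp by (simp add: robust_pmp_def)
    then show ?thesis
    proof eventually_elim
      case (elim \<alpha>)
      then obtain q where q: "has_W11_deriv T (\<lambda>t. p t \<alpha>) q"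
        "AE t in lebesgue_on {0..T}. - q t = transpose (A \<alpha>) *v p t \<alpha>" by blast
      show ?case
        unfolding f_def F_def Ab_def using costate_series[OF _ q] T by auto
    qed
  qed
  have AE_term: "AE \<alpha> in \<Lambda>. \<mu> \<alpha> \<ge> 0 \<and> - p T \<alpha> = \<mu> \<alpha> *\<^sub>R dpsi \<alpha>"
    using pmp unfolding robust_pmp_def dpsi_def by blast

  define G where "G j \<alpha> = (\<Sum>n. (real j * h) ^ n / fact n * (dpsi \<alpha> \<bullet> Ab n \<alpha>))" for j \<alpha>
  \<comment> \<open>Since the samples are \<open>- \<mu> (G j)\<close>, the least-squares quotient below recovers \<open>\<mu>\<close> from measurable data;
    where all \<open>G j\<close> vanish, division by zero yields the desired value \<open>0\<close>.\<close>
  define ratio where "ratio \<alpha> = - (\<Sum>j<?N. f (real j * h) \<alpha> * G j \<alpha>) / (\<Sum>j<?N. (G j \<alpha>)\<^sup>2)" for \<alpha>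
  \<comment> \<open>The truncation at \<open>0\<close> keeps \<open>v\<close> in the normal cone also on the exceptional null set, as the test maps
    are constrained at every active parameter.\<close>
  define v where "v \<alpha> = max 0 (ratio \<alpha>) *\<^sub>R dpsi \<alpha>" for \<alpha>
  have meas [measurable]: "dpsi \<in> borel_measurable \<Lambda>" "Ab n \<in> borel_measurable \<Lambda>" for n
    by (intro cont_meas dpsi_cont Ab_cont)+
  have f_meas: "f (real j * h) \<in> borel_measurable \<Lambda>" if "j < ?N" for j
    using f_int[OF jh[OF that]] by auto
  have G_meas [measurable]: "G j \<in> borel_measurable \<Lambda>" for j
    unfolding G_def by measurable
  have ratio_meas [measurable]: "ratio \<in> borel_measurable \<Lambda>"
    unfolding ratio_def
    by (intro borel_measurable_divide borel_measurable_uminus borel_measurable_sum borel_measurable_times f_meas G_meas borel_measurable_power) auto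
  have v_meas [measurable]: "v \<in> borel_measurable \<Lambda>"
    unfolding v_def by measurable

  have AE_v: "AE \<alpha> in \<Lambda>. \<forall>n. v \<alpha> \<bullet> Ab n \<alpha> = - F \<alpha> n"
    using AE_P AE_f AE_term
  proof eventually_elim
    case (elim \<alpha>)
    then have \<alpha>: "\<alpha> \<in> P" and \<mu>0: "\<mu> \<alpha> \<ge> 0" and pT: "p T \<alpha> = - (\<mu> \<alpha> *\<^sub>R dpsi \<alpha>)"
      by (blast, blast, metis minus_minus)
    have F: "F \<alpha> n = - \<mu> \<alpha> * (dpsi \<alpha> \<bullet> Ab n \<alpha>)" for n
      by (simp add: F_def pT)
    have fj: "f (real j * h) \<alpha> = - \<mu> \<alpha> * G j \<alpha>" if "j < ?N" for j
    proof -
      have "f (real j * h) \<alpha> = (\<Sum>n. (real j * h) ^ n / fact n * F \<alpha> n)"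
        using elim(2) jh[OF that] by blast
      also have "\<dots> = (\<Sum>n. - \<mu> \<alpha> * ((real j * h) ^ n / fact n * (dpsi \<alpha> \<bullet> Ab n \<alpha>)))"
        unfolding F by (simp add: mult_ac)
      also have "\<dots> = - \<mu> \<alpha> * G j \<alpha>"
        unfolding G_def
        by (rule suminf_mult[OF summable_norm_cancel[OF exp_majorant_summable[OF growth[OF \<alpha>]]]])
      finally show ?thesis .
    qed
    show ?case
    proof (cases "(\<Sum>j<?N. (G j \<alpha>)\<^sup>2) = 0")
      case False
      have "(\<Sum>j<?N. f (real j * h) \<alpha> * G j \<alpha>) = - \<mu> \<alpha> * (\<Sum>j<?N. (G j \<alpha>)\<^sup>2)"
        unfolding sum_distrib_left by (intro sum.cong) (auto simp: fj power2_eq_square)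
      then have "ratio \<alpha> = \<mu> \<alpha>" using False by (simp add: ratio_def)
      then show ?thesis using \<mu>0 by (simp add: v_def F)
    next
      case True
      then have "f (real j * h) \<alpha> = 0" if "j < ?N" for j
        using that fj[OF that] by (simp add: sum_nonneg_eq_0_iff)
      then have "(\<Sum>n. (real j * h) ^ n / fact n * F \<alpha> n) = 0" if "j < ?N" for j
        using that elim(2) jh[OF that] by metis
      then have "(\<Sum>k<?N. \<bar>F \<alpha> k\<bar>) \<le> 0"
        using samples[rule_format, of "F \<alpha>"] growth[OF \<alpha>, of "p T \<alpha>"] by (simp add: F_def)
      then have "\<bar>F \<alpha> n\<bar> \<le> 0" for n
        using growth[OF \<alpha>, of "p T \<alpha>" n] K unfolding F_def
        by (meson mult_nonneg_nonpos order_trans zero_le_one zero_le_power)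
      then show ?thesis using True by (simp add: v_def ratio_def)
    qed
  qed

  \<comment> \<open>The integrable majorant provided by the samples.\<close>
  define H where "H \<alpha> = Cs * (\<Sum>j<?N. \<bar>f (real j * h) \<alpha>\<bar>)" for \<alpha>
  have H_int: "integrable \<Lambda> H"
    unfolding H_def by (intro integrable_mult_right Bochner_Integration.integrable_sum integrable_abs f_int jh) auto
  have AE_H: "AE \<alpha> in \<Lambda>. \<forall>n. \<bar>v \<alpha> \<bullet> Ab n \<alpha>\<bar> \<le> K ^ n * H \<alpha>"
    using AE_P AE_f AE_v
  proof eventually_elim
    case (elim \<alpha>)
    have g: "\<bar>F \<alpha> n\<bar> \<le> K ^ n * (\<Sum>k<?N. \<bar>F \<alpha> k\<bar>)" for n
      unfolding F_def by (rule growth) (rule elim(1))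
    have "(\<Sum>k<?N. \<bar>F \<alpha> k\<bar>) \<le> Cs * (\<Sum>j<?N. \<bar>\<Sum>n. (real j * h) ^ n / fact n * F \<alpha> n\<bar>)"
      by (rule samples[rule_format]) (rule g)
    also have "\<dots> = H \<alpha>"
      unfolding H_def using elim(2) jh by (intro arg_cong[where f = "\<lambda>z. Cs * z"] sum.cong) auto
    finally have "K ^ n * (\<Sum>k<?N. \<bar>F \<alpha> k\<bar>) \<le> K ^ n * H \<alpha>" for n
      using K by (intro mult_left_mono) auto
    then have "\<bar>F \<alpha> n\<bar> \<le> K ^ n * H \<alpha>" for n using g order_trans by blast
    then show ?case using elim(3) by simp
  qed
  define c where "c n = (LINT \<alpha>|\<Lambda>. v \<alpha> \<bullet> Ab n \<alpha>)" for n
  have vA_int: "integrable \<Lambda> (\<lambda>\<alpha>. v \<alpha> \<bullet> Ab n \<alpha>)" for n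
  proof (rule Bochner_Integration.integrable_bound)
    show "integrable \<Lambda> (\<lambda>\<alpha>. K ^ n * H \<alpha>)" using H_int by simp
    show "AE \<alpha> in \<Lambda>. norm (v \<alpha> \<bullet> Ab n \<alpha>) \<le> norm (K ^ n * H \<alpha>)"
      using AE_H by eventually_elim (metis abs_ge_self order_trans real_norm_def)
  qed measurable
  have norm_int: "(LINT \<alpha>|\<Lambda>. \<bar>v \<alpha> \<bullet> Ab n \<alpha>\<bar>) \<le> K ^ n * (LINT \<alpha>|\<Lambda>. H \<alpha>)" for n
  proof -
    have "(LINT \<alpha>|\<Lambda>. \<bar>v \<alpha> \<bullet> Ab n \<alpha>\<bar>) \<le> (LINT \<alpha>|\<Lambda>. K ^ n * H \<alpha>)"
    proof (rule integral_mono_AE)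
      show "AE \<alpha> in \<Lambda>. \<bar>v \<alpha> \<bullet> Ab n \<alpha>\<bar> \<le> K ^ n * H \<alpha>"
        using AE_H by eventually_elim blast
    qed (use vA_int H_int in auto)
    then show ?thesis by simp
  qed
  have c_bound: "\<bar>c n\<bar> \<le> K ^ n * (LINT \<alpha>|\<Lambda>. H \<alpha>)" for n
  proof -
    have "\<bar>c n\<bar> \<le> (LINT \<alpha>|\<Lambda>. \<bar>v \<alpha> \<bullet> Ab n \<alpha>\<bar>)"
      unfolding c_def by (rule integral_abs_bound)
    with norm_int show ?thesis using order_trans by blast
  qed
  have phi_series: "phi b \<Lambda> p (T - s) = - (\<Sum>n. s ^ n / fact n * c n)" if s: "s \<in> {0..T}" for s
  proof -
    let ?g = "\<lambda>n \<alpha>. s ^ n / fact n * (v \<alpha> \<bullet> Ab n \<alpha>)"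
    have gi: "integrable \<Lambda> (?g n)" for n using vA_int by simp
    have "phi b \<Lambda> p (T - s) = (LINT \<alpha>|\<Lambda>. - (\<Sum>n. ?g n \<alpha>))"
      unfolding phi_def
    proof (rule integral_cong_AE)
      show "(\<lambda>\<alpha>. p (T - s) \<alpha> \<bullet> b \<alpha>) \<in> borel_measurable \<Lambda>"
        using f_int[OF s] unfolding f_def by auto
      show "AE \<alpha> in \<Lambda>. p (T - s) \<alpha> \<bullet> b \<alpha> = - (\<Sum>n. ?g n \<alpha>)"
        using AE_P AE_f AE_v
      proof eventually_elim
        case (elim \<alpha>)
        have "p (T - s) \<alpha> \<bullet> b \<alpha> = (\<Sum>n. s ^ n / fact n * F \<alpha> n)"
          using elim(2) s unfolding f_def by blast
        also have "\<dots> = (\<Sum>n. - ?g n \<alpha>)" using elim(3) by simp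
        also have "\<dots> = - (\<Sum>n. ?g n \<alpha>)"
          by (rule suminf_minus[OF summable_norm_cancel[OF exp_majorant_summable[OF growth[OF elim(1)]]]])
        finally show ?case .
      qed
    qed measurable
    also have "\<dots> = - (LINT \<alpha>|\<Lambda>. (\<Sum>n. ?g n \<alpha>))" by simp
    also have "(LINT \<alpha>|\<Lambda>. (\<Sum>n. ?g n \<alpha>)) = (\<Sum>n. LINT \<alpha>|\<Lambda>. ?g n \<alpha>)"
    proof (rule integral_suminf[OF gi])
      show "AE \<alpha> in \<Lambda>. summable (\<lambda>n. norm (?g n \<alpha>))"
        using AE_P by eventually_elim (rule exp_majorant_summable[OF growth])
      have "\<bar>LINT \<alpha>|\<Lambda>. \<bar>v \<alpha> \<bullet> Ab n \<alpha>\<bar>\<bar> \<le> K ^ n * (LINT \<alpha>|\<Lambda>. H \<alpha>)" for n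
        using norm_int by simp
      from exp_majorant_summable[OF this, of "\<bar>s\<bar>"]
      show "summable (\<lambda>n. LINT \<alpha>|\<Lambda>. norm (?g n \<alpha>))"
        by (simp add: abs_mult power_abs)
    qed
    also have "\<dots> = (\<Sum>n. s ^ n / fact n * c n)" by (simp add: c_def)
    finally show ?thesis .
  qed

  have act_sets: "active_set \<psi> P (\<lambda>\<alpha>. x \<alpha> T) \<in> sets \<Lambda>"
  proof -
    have "continuous_on P (\<lambda>\<alpha>. \<psi> (x \<alpha> T))"
      by (rule continuous_on_compose2[OF C1_on_continuous[OF \<psi>(1) subset_refl] x]) auto
    then have [measurable]: "(\<lambda>\<alpha>. \<psi> (x \<alpha> T)) \<in> borel_measurable \<Lambda>" by (rule cont_meas)
    have "{\<alpha> \<in> space \<Lambda>. \<psi> (x \<alpha> T) = 0} \<in> sets \<Lambda>" by measurable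
    then show ?thesis by (simp add: active_set_def sp)
  qed
  let ?act = "active_set \<psi> P (\<lambda>\<alpha>. x \<alpha> T)"
  let ?R = "restrict_space \<Lambda> ?act"
  \<comment> \<open>The measure is carried by its support, where the terminal constraint is active.\<close>
  have AE_act: "AE \<alpha> in \<Lambda>. \<alpha> \<in> ?act"
    using AE_in_measure_supp[OF radon] by eventually_elim (use pmp in \<open>auto simp: robust_pmp_def active_set_def\<close>)
  have act_sp: "?act \<inter> space \<Lambda> \<in> sets \<Lambda>" using act_sets by auto
  have nondeg: False if cz: "\<And>n. n > 0 \<Longrightarrow> c n = 0" and c0: "c 0 \<noteq> 0"
  proof -
    have R_int: "integrable ?R (\<lambda>\<alpha>. Ab m \<alpha> \<bullet> v \<alpha>)" for m
      unfolding integrable_restrict_space[OF act_sp] using vA_int[of m]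
      by (subst (asm) inner_commute) (rule integrable_mult_indicator[OF act_sets])
    have R_eq: "(LINT \<alpha>|?R. Ab m \<alpha> \<bullet> v \<alpha>) = c m" for m
      unfolding integral_restrict_space[OF act_sp] c_def
      by (rule integral_cong_AE) (use act_sets AE_act in \<open>auto simp: inner_commute elim!: eventually_mono\<close>)
    have "v \<in> borel_measurable ?R" by (rule measurable_restrict_space1) (rule v_meas)
    moreover have "\<forall>\<alpha>\<in>?act. v \<alpha> \<in> normal_cone (terminal_set \<psi>) (x \<alpha> T)"
    proof
      fix \<alpha> assume "\<alpha> \<in> ?act"
      then have "dpsi \<alpha> \<in> normal_cone (terminal_set \<psi>) (x \<alpha> T)"
        unfolding dpsi_def
        by (intro gradient_in_normal_cone[OF \<psi>(2) C1_on_gradient(1)[OF \<psi>(1)]]) (simp add: active_set_def)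
      then show "v \<alpha> \<in> normal_cone (terminal_set \<psi>) (x \<alpha> T)"
        by (auto simp: normal_cone_def v_def intro!: mult_nonneg_nonpos)
    qed
    moreover have "\<not> (\<exists>m\<in>{1..CARD('d) - 1}. (LINT \<alpha>|?R. Ab m \<alpha> \<bullet> v \<alpha>) \<noteq> 0)"
      unfolding R_eq using cz by auto
    ultimately have "AE \<alpha> in ?R. v \<alpha> = 0"
      using ctrl R_int unfolding avg_controllability_def Let_def Ab_def by blast
    then have "AE \<alpha> in \<Lambda>. \<alpha> \<in> ?act \<longrightarrow> v \<alpha> = 0"
      by (simp add: AE_restrict_space_iff[OF act_sp])
    then have "AE \<alpha> in \<Lambda>. v \<alpha> \<bullet> Ab 0 \<alpha> = 0"
      using AE_act by eventually_elim simp
    then have "c 0 = 0" unfolding c_def by (rule integral_eq_zero_AE)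
    with c0 show False by simp
  qed
  have fin: "finite {t \<in> {0..T}. phi b \<Lambda> p t = a}" if a: "a \<noteq> 0" for a
  proof (rule ccontr)
    assume inf: "infinite {t \<in> {0..T}. phi b \<Lambda> p t = a}"
    let ?X = "{s \<in> {0..T}. phi b \<Lambda> p (T - s) = a}"
    \<comment> \<open>Pass to reversed time, in which the series is centred.\<close>
    have "{t \<in> {0..T}. phi b \<Lambda> p t = a} \<subseteq> (\<lambda>s. T - s) ` ?X"
    proof
      fix t assume "t \<in> {t \<in> {0..T}. phi b \<Lambda> p t = a}"
      then have "T - t \<in> ?X" "t = T - (T - t)" by auto
      then show "t \<in> (\<lambda>s. T - s) ` ?X" by blast
    qed
    then have X: "infinite ?X" using inf finite_subset by blast
    have "bounded ?X" by (rule bounded_subset[of "{0..T}"]) auto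
    moreover have "(\<Sum>n. s ^ n / fact n * c n) = - a" if "s \<in> ?X" for s
      using that phi_series[of s] by auto
    ultimately have "\<And>n. n > 0 \<Longrightarrow> c n = 0" "c 0 = - a"
      using entire_series_coeffs_zero[of c, OF c_bound X] by blast+
    with a show False using nondeg by auto
  qed
  have "finite ({t \<in> {0..T}. phi b \<Lambda> p t = \<eta>} \<union> {t \<in> {0..T}. phi b \<Lambda> p t = - \<eta>})"
    using fin \<eta> by simp
  then have "{t \<in> {0..T}. phi b \<Lambda> p t = \<eta>} \<union> {t \<in> {0..T}. phi b \<Lambda> p t = - \<eta>} \<in> null_sets lebesgue"
    by (simp add: negligible_iff_null_sets[symmetric] negligible_finite)
  then have "AE t in lebesgue. t \<in> {0..T} \<longrightarrow> phi b \<Lambda> p t \<noteq> \<eta> \<and> phi b \<Lambda> p t \<noteq> - \<eta>"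
    by (rule AE_I') auto
  then have "AE t in lebesgue_on {0..T}. phi b \<Lambda> p t \<noteq> \<eta> \<and> phi b \<Lambda> p t \<noteq> - \<eta>"
    by (subst AE_restrict_space_iff) auto
  moreover have "AE t in lebesgue_on {0..T}.
        is_arg_max (\<lambda>v. phi b \<Lambda> p t * v - \<eta> * \<bar>v\<bar>) (\<lambda>v. v \<in> {-1..1}) (u t)"
    using pmp by (simp add: robust_pmp_def)
  ultimately show ?thesis
    by eventually_elim (use maximiser_bang_off_bang[OF _ \<eta>] in blast)
qed

section \<open>Equality of the sets of minimisers\<close>

lemma admissible_midpoint:
  assumes T: "T \<ge> 0" and \<psi>: "convex_on UNIV \<psi>"
    and u: "u \<in> admissible A b xbar T \<psi> P" and w: "w \<in> admissible A b xbar T \<psi> P"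
  shows "(\<lambda>t. 1/2 * u t + 1/2 * w t) \<in> admissible A b xbar T \<psi> P"
proof -
  have L: "u \<in> Linf T" "w \<in> Linf T" and bu: "AE t in lebesgue_on {0..T}. u t \<in> {-1..1}"
    and bw: "AE t in lebesgue_on {0..T}. w t \<in> {-1..1}"
    using u w by (auto simp: admissible_def)
  have "AE t in lebesgue_on {0..T}. 1/2 * u t + 1/2 * w t \<in> {-1..1}"
    using bu bw by eventually_elim auto
  moreover have "\<psi> (trajectory A b xbar T (\<lambda>t. 1/2 * u t + 1/2 * w t) \<alpha> T) \<le> 0" if \<alpha>: "\<alpha> \<in> P" for \<alpha>
  proof -
    let ?xu = "trajectory A b xbar T u \<alpha> T" and ?xw = "trajectory A b xbar T w \<alpha> T"
    have "trajectory A b xbar T (\<lambda>t. 1/2 * u t + 1/2 * w t) \<alpha> T = (1/2) *\<^sub>R ?xu + (1/2) *\<^sub>R ?xw"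
      by (rule trajectory_affine[OF T L]) (use T in auto)
    moreover have "\<psi> ((1/2) *\<^sub>R ?xu + (1/2) *\<^sub>R ?xw) \<le> 1/2 * \<psi> ?xu + 1/2 * \<psi> ?xw"
      using convex_onD[OF \<psi>, of "1/2" ?xu ?xw] by simp
    moreover have "\<psi> ?xu \<le> 0" "\<psi> ?xw \<le> 0" using u w \<alpha> by (auto simp: admissible_def)
    ultimately show ?thesis by simp
  qed
  ultimately show ?thesis
    using Linf_combination[OF L] unfolding admissible_def by blast
qed

text \<open>
Almost everywhere convergence preserves the bounds on the control, and \<open>L\<^sup>1\<close> convergence preserves the
terminal constraint.
\<close>

lemma admissible_closed:
  assumes T: "T \<ge> 0" and \<psi>: "continuous_on UNIV \<psi>"
    and s: "\<And>n. s n \<in> admissible A b xbar T \<psi> P" and w: "w \<in> borel_measurable (lebesgue_on {0..T})"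
    and ae: "AE t in lebesgue_on {0..T}. (\<lambda>n. s n t) \<longlonglongrightarrow> w t"
    and lim: "(\<lambda>n. LINT t|lebesgue_on {0..T}. \<bar>s n t - w t\<bar>) \<longlonglongrightarrow> 0"
  shows "w \<in> admissible A b xbar T \<psi> P"
proof -
  let ?M = "lebesgue_on {0..T}"
  have sL: "s n \<in> Linf T" for n using s[of n] by (simp add: admissible_def)
  have "AE t in ?M. s n t \<in> {-1..1}" for n using s[of n] by (simp add: admissible_def)
  then have "AE t in ?M. \<forall>n. s n t \<in> {-1..1}" by (simp add: AE_all_countable)
  then have bw: "AE t in ?M. w t \<in> {-1..1}"
    using ae
  proof eventually_elim
    case (elim t)
    show ?case
      by (rule closed_sequentially[OF _ _ elim(2)]) (use elim(1) in auto)
  qed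
  have "AE t in ?M. \<bar>w t\<bar> \<le> 1" using bw by eventually_elim auto
  then have wL: "w \<in> Linf T" using w by (auto simp: Linf_def)
  have "\<psi> (trajectory A b xbar T w \<alpha> T) \<le> 0" if \<alpha>: "\<alpha> \<in> P" for \<alpha>
  proof -
    obtain C where C: "\<And>u w. u \<in> Linf T \<Longrightarrow> w \<in> Linf T \<Longrightarrow>
      norm (trajectory A b xbar T u \<alpha> T - trajectory A b xbar T w \<alpha> T)
      \<le> C * integral {0..T} (\<lambda>t. \<bar>u t - w t\<bar>)"
      using trajectory_lipschitz[OF T, of A b xbar \<alpha>] by metis
    have HK: "integral {0..T} (\<lambda>t. \<bar>s n t - w t\<bar>) = (LINT t|?M. \<bar>s n t - w t\<bar>)" for n
      using Linf_integrable(1)[OF sL[of n]] Linf_integrable(1)[OF wL]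
      by (intro lebesgue_integral_eq_integral[symmetric]) auto
    have bound: "norm (trajectory A b xbar T (s n) \<alpha> T - trajectory A b xbar T w \<alpha> T)
        \<le> C * (LINT t|?M. \<bar>s n t - w t\<bar>)" for n
      using C[OF sL[of n] wL] by (simp only: HK)
    have "(\<lambda>n. C * (LINT t|?M. \<bar>s n t - w t\<bar>)) \<longlonglongrightarrow> 0"
      using tendsto_mult_right_zero[OF lim] .
    then have "(\<lambda>n. trajectory A b xbar T (s n) \<alpha> T - trajectory A b xbar T w \<alpha> T) \<longlonglongrightarrow> 0"
      by (rule Lim_null_comparison[OF always_eventually[OF allI[OF bound]]])
    then have "(\<lambda>n. trajectory A b xbar T (s n) \<alpha> T) \<longlonglongrightarrow> trajectory A b xbar T w \<alpha> T"
      by (rule LIM_zero_cancel)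
    then have "(\<lambda>n. \<psi> (trajectory A b xbar T (s n) \<alpha> T)) \<longlonglongrightarrow> \<psi> (trajectory A b xbar T w \<alpha> T)"
      by (rule continuous_on_tendsto_compose[OF \<psi>]) auto
    then show ?thesis
      by (rule LIMSEQ_le_const2) (use s \<alpha> in \<open>auto simp: admissible_def\<close>)
  qed
  with wL bw show ?thesis unfolding admissible_def by blast
qed

lemma minimizers_J1_nonempty:
  assumes T: "T \<ge> 0" and \<psi>: "continuous_on UNIV \<psi>" "convex_on UNIV \<psi>"
    and ne: "admissible A b xbar T \<psi> P \<noteq> {}"
  shows "minimizers (J1 T) (admissible A b xbar T \<psi> P) \<noteq> {}"
proof -
  interpret finite_measure "lebesgue_on {0..T}" by (rule finite_measure_lebesgue_on) auto
  let ?U = "admissible A b xbar T \<psi> P"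
  have meas: "u \<in> borel_measurable (lebesgue_on {0..T})" if "u \<in> ?U" for u
    using that by (auto simp: admissible_def Linf_def)
  have bdd: "AE t in lebesgue_on {0..T}. \<bar>u t\<bar> \<le> 1" if "u \<in> ?U" for u
  proof -
    have "AE t in lebesgue_on {0..T}. u t \<in> {-1..1}" using that by (simp add: admissible_def)
    then show ?thesis by eventually_elim auto
  qed
  have "\<exists>u\<in>?U. \<forall>w\<in>?U. (LINT t|lebesgue_on {0..T}. \<bar>u t\<bar>) \<le> (LINT t|lebesgue_on {0..T}. \<bar>w t\<bar>)"
    by (rule L1_minimizer_exists[OF ne meas bdd admissible_midpoint[OF T \<psi>(2)] admissible_closed[OF T \<psi>(1)]])
  then show ?thesis unfolding minimizers_def J1_def by blast
qed

text \<open>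
If a lower bound \<open>f\<close> of \<open>g\<close> is attained by \<open>g\<close> at all minimisers of \<open>f\<close>, both functionals have the same
infimum, and it is attained at the same points: a minimiser of \<open>g\<close> does at least as well for \<open>f\<close> as a
minimiser of \<open>f\<close>.
\<close>

lemma minimizers_eq_of_tight_lower_bound:
  fixes f g :: "'u \<Rightarrow> real"
  assumes le: "\<And>u. u \<in> U \<Longrightarrow> f u \<le> g u" and eq: "\<And>u. u \<in> minimizers f U \<Longrightarrow> f u = g u"
    and ne: "minimizers f U \<noteq> {}"
  shows "minimizers g U = minimizers f U"
proof -
  obtain m where m: "m \<in> minimizers f U" using ne by blast
  then have mU: "m \<in> U" "\<And>w. w \<in> U \<Longrightarrow> f m \<le> f w" by (auto simp: minimizers_def)
  show ?thesis
  proof (intro equalityI subsetI)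
    fix u assume u: "u \<in> minimizers g U"
    then have uU: "u \<in> U" and "g u \<le> g m" using mU by (auto simp: minimizers_def)
    then have "f u \<le> f m" using le[OF uU] eq[OF m] by linarith
    then have "f u \<le> f w" if "w \<in> U" for w using mU(2)[OF that] by linarith
    then show "u \<in> minimizers f U" using uU by (simp add: minimizers_def)
  next
    fix u assume u: "u \<in> minimizers f U"
    then have uU: "u \<in> U" and "\<And>w. w \<in> U \<Longrightarrow> f u \<le> f w" by (auto simp: minimizers_def)
    then have "g u \<le> g w" if "w \<in> U" for w
      using le[OF that] eq[OF u] that by fastforce
    then show "u \<in> minimizers g U" using uU by (simp add: minimizers_def)
  qed
qed

theorem theorem3p6:
  fixes A :: "real^'n \<Rightarrow> real^'d^'d"
    and b :: "real^'n \<Rightarrow> real^'d"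
    and xbar :: "real^'d"
    and T :: real
    and \<psi> :: "real^'d \<Rightarrow> real"
    and P V :: "(real^'n) set"
  assumes "T > 0"
    and "P \<noteq> {}" and "compact P" and "convex P"
    and "open V" and "P \<subseteq> V" and "C1_on A V" and "C1_on b V"
    and "C1_on \<psi> UNIV" and "convex_on UNIV \<psi>"
    and "compact (terminal_set \<psi>)" and "convex (terminal_set \<psi>)"
    and "admissible A b xbar T \<psi> P \<noteq> {}"
    and "\<forall>u \<in> minimizers (J1 T) (admissible A b xbar T \<psi> P).
           \<exists>\<eta> \<Lambda> p \<mu>.
             robust_pmp A b T \<psi> P u (trajectory A b xbar T u) \<eta> \<Lambda> p \<mu> \<and>
             \<eta> > 0 \<and>
             avg_controllability A b \<psi> P (\<lambda>\<alpha>. trajectory A b xbar T u \<alpha> T) \<Lambda>"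
  shows "minimizers (J0 T) (admissible A b xbar T \<psi> P) =
         minimizers (J1 T) (admissible A b xbar T \<psi> P)"
proof (rule minimizers_eq_of_tight_lower_bound)
  let ?U = "admissible A b xbar T \<psi> P"
  have T: "T \<ge> 0" using assms(1) by simp
  have A: "continuous_on P A" and b: "continuous_on P b" and \<psi>: "continuous_on UNIV \<psi>"
    using assms C1_on_continuous by blast+
  have U: "u \<in> Linf T" "AE t in lebesgue_on {0..T}. u t \<in> {-1..1}" if "u \<in> ?U" for u
    using that by (auto simp: admissible_def)
  show "J1 T u \<le> J0 T u" if "u \<in> ?U" for u
    using J1_le_J0(1) U[OF that] by blast
  show "J1 T u = J0 T u" if u: "u \<in> minimizers (J1 T) ?U" for u
  proof -
    have uU: "u \<in> ?U" using u by (simp add: minimizers_def)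
    obtain \<eta> \<Lambda> p \<mu> where
      "robust_pmp A b T \<psi> P u (trajectory A b xbar T u) \<eta> \<Lambda> p \<mu>" "\<eta> > 0"
      "avg_controllability A b \<psi> P (\<lambda>\<alpha>. trajectory A b xbar T u \<alpha> T) \<Lambda>"
      using assms(14) u by blast
    then have "AE t in lebesgue_on {0..T}. u t \<in> {-1, 0, 1}"
      by (rule bang_off_bang[where x = "trajectory A b xbar T u", OF assms(1,3) A b assms(9,10) trajectory_end_continuous[OF T assms(3) A b U(1)[OF uU]]])
    then show ?thesis using J1_le_J0(2) U[OF uU] by blast
  qed
  show "minimizers (J1 T) ?U \<noteq> {}"
    by (rule minimizers_J1_nonempty[OF T \<psi> assms(10) assms(13)])
qed

end
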